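(* Let $\overline{\mathsf{S}}$ be a closed strip of $\mathbb{C}$ and let $T$ be an operator on a complex Hilbert space $\mathcal{H}$ with numerical range in $\overline{\mathsf{S}}$. The following statements are equivalent: 1. $R(T-\lambda I)=\mathcal{H}$ for some $\lambda\in\overline{\mathsf{S}}^c$; 2. a connected component of $\overline{\mathsf{S}}^c$ is contained in the resolvent set $\rho(T)$ of $T$ (i.e., a defect index of $T$ is $0$); 3. $T$ is $\overline{\mathsf{S}}$-maximal and densely defined. If these conditions are satisfied, then $T$ is closed.
   Context: $\mathcal{H}$ is a complex Hilbert space with inner product $\langle\cdot|\cdot\rangle$ and norm $\|\cdot\|$. An operator $T$ on $\mathcal{H}$ is a linear map from a linear subspace $D(T)\subseteq\mathcal{H}$ to $\mathcal{H}$; it is not assumed bounded, closed or densely defined unless stated. $R(T)$ is its range. $T\subseteq T'$ means that $T'$ extends $T$. The numerical range of $T$ is $\mathfrak{n}_T:=\{\langle T\xi|\xi\rangle:\xi\in D(T),\|\xi\|=1\}$. The resolvent set $\rho(T)$ is the set of $\lambda\in\mathbb{C}$ such that $T-\lambda I:D(T)\to\mathcal{H}$ is a bijection with bounded inverse. For $E\subseteq\mathbb{C}$, $E^c=\mathbb{C}\setminus E$. Defect index: for $\lambda\in\overline{\mathsf{S}}^c$ (with $\mathfrak{n}_T\subseteq\overline{\mathsf{S}}$) one considers the number $\dim R(T-\lambda I)^\perp$; for closable $T$ it is constant on each connected component of $\overline{\mathsf{S}}^c$, and it is called a defect index of $T$. For a nonempty, convex, proper subset $\mathfrak{n}$ of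 $\mathbb{C}$, an operator $T$ is called $\mathfrak{n}$-maximal if (1) $\mathfrak{n}_T\subseteq\mathfrak{n}$ and (2) whenever $T'$ is an operator with $T\subseteq T'$ and $\mathfrak{n}_{T'}\subseteq\mathfrak{n}$, then $T=T'$. A closed strip is a set $\overline{\mathsf{S}}=a\,\overline{\mathsf{S}_\alpha}+b$, where $a\in\mathbb{C}\setminus\{0\}$, $b\in\mathbb{R}$, $\alpha\ge 0$ and $\overline{\mathsf{S}_\alpha}=\{\lambda\in\mathbb{C}:|\Im\lambda|\le\alpha\}$.
   Formalization: The gloss in 2, "i.e., a defect index of T is 0", is stated as an equivalence only for closed T; for non-closed T it fails, e.g. multiplication by n on finitely supported sequences in ℓ² has defect indices 0 but no non-real λ in ρ(T). *)

theory Defs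
  imports "HOL-Analysis.Analysis" "HOL-Library.Extended_Nat"
begin

(* The inner product is linear in its first argument, as is needed for the numerical range
   of T - c I to be that of T shifted by -c. The identity 1 x = x follows from scaleR_scaleC;
   completeness comes from banach. *)
class complex_hilbert_space = banach +
  fixes scaleC :: "complex \<Rightarrow> 'a \<Rightarrow> 'a" (infixr "*\<^sub>C" 75)
    and cinner :: "'a \<Rightarrow> 'a \<Rightarrow> complex"
  assumes scaleC_add_right: "c *\<^sub>C (x + y) = c *\<^sub>C x + c *\<^sub>C y"
    and scaleC_add_left: "(c + d) *\<^sub>C x = c *\<^sub>C x + d *\<^sub>C x"
    and scaleC_scaleC: "c *\<^sub>C (d *\<^sub>C x) = (c * d) *\<^sub>C x"
    and scaleR_scaleC: "scaleR r x = complex_of_real r *\<^sub>C x"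
    and cinner_add_left: "cinner (x + y) z = cinner x z + cinner y z"
    and cinner_scaleC_left: "cinner (c *\<^sub>C x) y = c * cinner x y"
    and cinner_commute: "cinner y x = cnj (cinner x y)"
    and cinner_norm: "cinner x x = complex_of_real ((norm x)\<^sup>2)"

global_interpretation complex_vector:
  vector_space "scaleC :: complex \<Rightarrow> 'a \<Rightarrow> 'a::complex_hilbert_space"
proof
  fix x :: 'a
  show "1 *\<^sub>C x = x"
    using scaleR_scaleC[of 1 x] by simp
qed (simp_all add: scaleC_add_right scaleC_add_left scaleC_scaleC)

(* An operator is a partial map: D(T) is dom T, R(T) is ran T, extension of operators is
   map_le, and equality of maps is equality of operators (including domains). *)
definition is_operator :: "('a::complex_hilbert_space \<rightharpoonup> 'a) \<Rightarrow> bool" where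
  "is_operator T \<longleftrightarrow> complex_vector.subspace (dom T) \<and>
     (\<forall>x\<in>dom T. \<forall>y\<in>dom T. the (T (x + y)) = the (T x) + the (T y)) \<and>
     (\<forall>c. \<forall>x\<in>dom T. the (T (c *\<^sub>C x)) = c *\<^sub>C the (T x))"

definition op_shift :: "('a::complex_hilbert_space \<rightharpoonup> 'a) \<Rightarrow> complex \<Rightarrow> ('a \<rightharpoonup> 'a)" where
  "op_shift T c = (\<lambda>x. map_option (\<lambda>y. y - c *\<^sub>C x) (T x))"

definition numerical_range :: "('a::complex_hilbert_space \<rightharpoonup> 'a) \<Rightarrow> complex set" where
  "numerical_range T = {cinner (the (T x)) x | x. x \<in> dom T \<and> norm x = 1}"

definition resolvent_set :: "('a::complex_hilbert_space \<rightharpoonup> 'a) \<Rightarrow> complex set" where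
  "resolvent_set T = {c.
     let f = (\<lambda>x. the (op_shift T c x)) in
       bij_betw f (dom T) UNIV \<and>
       (\<exists>K. \<forall>y. norm (the_inv_into (dom T) f y) \<le> K * norm y)}"

definition closed_operator :: "('a::complex_hilbert_space \<rightharpoonup> 'a) \<Rightarrow> bool" where
  "closed_operator T \<longleftrightarrow> closed (Map.graph T)"

definition densely_defined :: "('a::complex_hilbert_space \<rightharpoonup> 'a) \<Rightarrow> bool" where
  "densely_defined T \<longleftrightarrow> closure (dom T) = UNIV"

definition nr_maximal :: "complex set \<Rightarrow> ('a::complex_hilbert_space \<rightharpoonup> 'a) \<Rightarrow> bool" where
  "nr_maximal N T \<longleftrightarrow> numerical_range T \<subseteq> N \<and>
     (\<forall>T'. is_operator T' \<and> T \<subseteq>\<^sub>m T' \<and> numerical_range T' \<subseteq> N \<longrightarrow> T = T')"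

definition closed_strip :: "complex set \<Rightarrow> bool" where
  "closed_strip S \<longleftrightarrow> (\<exists>(a::complex) (b::real) (\<alpha>::real). a \<noteq> 0 \<and> \<alpha> \<ge> 0 \<and>
     S = (\<lambda>z. a * z + complex_of_real b) ` {z. \<bar>Im z\<bar> \<le> \<alpha>})"

definition orth_compl :: "'a::complex_hilbert_space set \<Rightarrow> 'a set" where
  "orth_compl V = {y. \<forall>x\<in>V. cinner x y = 0}"

(* Complex dimension of a subspace. The library's dim is 0 on infinite-dimensional spaces,
   so an enat-valued version is used; infinite dimensions are not distinguished. *)
definition cdim :: "'a::complex_hilbert_space set \<Rightarrow> enat" where
  "cdim V = Sup {enat (card B) | B. B \<subseteq> V \<and> finite B \<and> complex_vector.independent B}"

(* n is the value, on some connected component of the complement of S, of the locally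
   constant function c \<mapsto> dim R(T - c I)^\<bottom> (T closable, numerical range in S). *)
definition is_defect_index ::
    "complex set \<Rightarrow> ('a::complex_hilbert_space \<rightharpoonup> 'a) \<Rightarrow> enat \<Rightarrow> bool" where
  "is_defect_index S T n \<longleftrightarrow>
     (\<exists>C\<in>components (- S). \<forall>c\<in>C. cdim (orth_compl (ran (op_shift T c))) = n)"

end

theory Submission
  imports Defs
begin

text \<open>
If \<open>c\<close> has distance \<open>d > 0\<close> from \<open>S\<close>, then \<open>\<parallel>(T - c) x\<parallel> \<ge> d \<parallel>x\<parallel>\<close> on the domain of \<open>T\<close>
(\<open>numerical_range_lower_bound\<close>).  So outside \<open>S\<close>, surjectivity of \<open>T - c\<close> is the same as membership of
\<open>c\<close> in the resolvent set.  By a contraction argument it persists for \<open>c'\<close> closer to \<open>c\<close> than \<open>d\<close>, and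
therefore spreads over the connected component of \<open>c\<close> (\<open>surjective_shift_on_connected\<close>).
Surjectivity at one point outside \<open>S\<close> also makes \<open>T\<close> closed, densely defined and maximal.  If \<open>T\<close> is known
to be closed, the lower bound makes the range of \<open>T - c\<close> closed, so that the range is everything precisely
when its orthogonal complement has dimension zero.

The remaining implication, from maximality and density of the domain to surjectivity, rests on a splitting.
After an affine change of variable the strip is \<open>\<bar>Im z\<bar> \<le> \<alpha>\<close>.  The Hermitian form
\<open>b x y = (\<langle>T x|y\<rangle> - \<langle>x|T y\<rangle>) / 2\<i>\<close> is then bounded by \<open>\<alpha>\<close> and comes from a bounded operator \<open>B\<close> with
\<open>\<parallel>B\<parallel> \<le> \<alpha>\<close> (\<open>bounded_imaginary_part\<close>), so \<open>T = A + \<i> B\<close> with \<open>A\<close> symmetric.  Symmetric extensions of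
\<open>A\<close> correspond to extensions of \<open>T\<close> within the strip, hence \<open>A\<close> is maximal symmetric.  By von
Neumann's extension argument one of the operators \<open>A - \<i> s\<close>, \<open>A + \<i> s\<close> is surjective for each \<open>s > 0\<close>
(\<open>maximal_symmetric_surjective\<close>): vectors of equal norm in the two defect spaces would otherwise
provide a symmetric extension.  For \<open>s > \<alpha>\<close> the summand \<open>\<i> B\<close> is a small perturbation, so surjectivity passes
to \<open>T\<close>.
\<close>

section \<open>Complex inner product spaces\<close>

lemma cinner_add_right: "cinner x (y + z) = cinner x y + cinner x (z::'a::complex_hilbert_space)"
  by (metis cinner_add_left cinner_commute complex_cnj_add)

lemma cinner_scaleC_right: "cinner x (c *\<^sub>C y) = cnj c * cinner x (y::'a::complex_hilbert_space)"
  by (metis cinner_commute cinner_scaleC_left complex_cnj_mult)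

lemma cinner_zero_left [simp]: "cinner 0 (y::'a::complex_hilbert_space) = 0"
  using cinner_scaleC_left[of 0 0 y] by simp

lemma cinner_zero_right [simp]: "cinner (y::'a::complex_hilbert_space) 0 = 0"
  using cinner_scaleC_right[of y 0 0] by simp

lemma cinner_minus_left: "cinner (- x) (y::'a::complex_hilbert_space) = - cinner x y"
  using cinner_add_left[of x "- x" y] by (simp add: minus_unique)

lemma cinner_minus_right: "cinner x (- (y::'a::complex_hilbert_space)) = - cinner x y"
  using cinner_add_right[of x y "- y"] by (simp add: minus_unique)

lemma cinner_diff_left: "cinner (x - y) (z::'a::complex_hilbert_space) = cinner x z - cinner y z"
  using cinner_add_left[of x "- y" z] by (simp add: cinner_minus_left)

lemma cinner_diff_right: "cinner x (y - (z::'a::complex_hilbert_space)) = cinner x y - cinner x z"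
  using cinner_add_right[of x y "- z"] by (simp add: cinner_minus_right)

lemmas cinner_algebra = cinner_add_left cinner_add_right cinner_diff_left cinner_diff_right
  cinner_minus_left cinner_minus_right cinner_scaleC_left cinner_scaleC_right

lemma norm_scaleC: "norm (c *\<^sub>C (x::'a::complex_hilbert_space)) = cmod c * norm x"
proof -
  have "cinner (c *\<^sub>C x) (c *\<^sub>C x) = c * cnj c * cinner x x"
    by (simp add: cinner_scaleC_left cinner_scaleC_right)
  also have "c * cnj c = complex_of_real ((cmod c)\<^sup>2)"
    by (simp only: complex_norm_square)
  finally have "complex_of_real ((norm (c *\<^sub>C x))\<^sup>2) = complex_of_real ((cmod c * norm x)\<^sup>2)"
    by (simp only: cinner_norm of_real_mult[symmetric] power_mult_distrib)
  then show ?thesis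
    unfolding of_real_eq_iff by (simp add: power2_eq_iff_nonneg)
qed

lemma norm_add_square:
  "(norm (x + (y::'a::complex_hilbert_space)))\<^sup>2 = (norm x)\<^sup>2 + 2 * Re (cinner x y) + (norm y)\<^sup>2"
proof -
  have n: "(norm z)\<^sup>2 = Re (cinner z z)" for z :: 'a
    by (simp add: cinner_norm)
  show ?thesis
    unfolding n using cinner_commute[of x y] by (simp add: cinner_algebra)
qed

lemma norm_diff_square:
  "(norm (x - (y::'a::complex_hilbert_space)))\<^sup>2 = (norm x)\<^sup>2 - 2 * Re (cinner x y) + (norm y)\<^sup>2"
  using norm_add_square[of x "- y"] by (simp add: cinner_minus_right)

lemma cauchy_schwarz: "cmod (cinner x (y::'a::complex_hilbert_space)) \<le> norm x * norm y"
proof (cases "y = 0")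
  case False
  define t where "t = cinner x y / complex_of_real ((norm y)\<^sup>2)"
  have "0 \<le> (norm (x - t *\<^sub>C y))\<^sup>2"
    by simp
  also have "\<dots> = (norm x)\<^sup>2 - (cmod (cinner x y))\<^sup>2 / (norm y)\<^sup>2"
  proof -
    have "Re (cinner x (t *\<^sub>C y)) = (cmod (cinner x y))\<^sup>2 / (norm y)\<^sup>2"
      unfolding t_def cinner_scaleC_right cmod_power2
      by (simp add: power2_eq_square add_divide_distrib)
    moreover have "(norm (t *\<^sub>C y))\<^sup>2 = (cmod (cinner x y))\<^sup>2 / (norm y)\<^sup>2"
      using False by (simp add: t_def norm_scaleC norm_divide norm_mult power2_eq_square)
    ultimately show ?thesis
      by (simp add: norm_diff_square)
  qed
  finally have "(cmod (cinner x y))\<^sup>2 \<le> (norm x * norm y)\<^sup>2"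
    using False by (simp add: divide_simps power_mult_distrib)
  then show ?thesis
    by (rule power2_le_imp_le) simp
qed simp

interpretation cinner: bounded_bilinear "cinner :: 'a::complex_hilbert_space \<Rightarrow> 'a \<Rightarrow> complex"
proof
  show "\<exists>K. \<forall>a b::'a. cmod (cinner a b) \<le> norm a * norm b * K"
    using cauchy_schwarz by (intro exI[of _ 1]) auto
qed (simp_all add: cinner_algebra scaleR_scaleC scaleR_conv_of_real)

interpretation scaleC: bounded_bilinear "scaleC :: complex \<Rightarrow> 'a \<Rightarrow> 'a::complex_hilbert_space"
proof
  show "\<exists>K. \<forall>a (b::'a). norm (a *\<^sub>C b) \<le> norm a * norm b * K"
    by (intro exI[of _ 1]) (simp add: norm_scaleC)
qed (simp_all add: scaleC_add_right scaleC_add_left scaleR_scaleC scaleC_scaleC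
      scaleR_conv_of_real mult.commute)

section \<open>Representation of functionals on subspaces\<close>

text \<open>The subspace need not be closed.  The representing vector is the limit of a sequence in \<open>D\<close> that
minimises \<open>J y = \<parallel>y\<parallel>\<^sup>2 - 2 Re (f y)\<close>: the vanishing of the first variation of \<open>J\<close> at that limit, in
the directions \<open>x\<close> and \<open>\<i> x\<close> of \<open>D\<close>, says that it represents \<open>f\<close>.  That the vector lies in the
closure of \<open>D\<close> makes the orthogonal projection onto this closure a special case.\<close>

lemma riesz_on_subspace:
  fixes D :: "'a::complex_hilbert_space set" and f :: "'a \<Rightarrow> complex"
  assumes D: "complex_vector.subspace D"
    and add: "\<And>x y. x \<in> D \<Longrightarrow> y \<in> D \<Longrightarrow> f (x + y) = f x + f y"
    and scale: "\<And>c x. x \<in> D \<Longrightarrow> f (c *\<^sub>C x) = c * f x"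
    and bound: "\<And>x. x \<in> D \<Longrightarrow> cmod (f x) \<le> K * norm x"
    and K: "0 \<le> K"
  shows "\<exists>z\<in>closure D. norm z \<le> K \<and> (\<forall>y\<in>D. f y = cinner y z)"
proof -
  define J where "J y = (norm y)\<^sup>2 - 2 * Re (f y)" for y
  define m where "m = Inf (J ` D)"
  note sub = complex_vector.subspace_add[OF D] complex_vector.subspace_scale[OF D]
    complex_vector.subspace_0[OF D]
  have subR: "r *\<^sub>R x \<in> D" if "x \<in> D" for r x
    using that by (simp add: scaleR_scaleC sub)
  have fR: "f (r *\<^sub>R x) = complex_of_real r * f x" if "x \<in> D" for r x
    using that by (simp add: scaleR_scaleC scale)
  have bdd: "bdd_below (J ` D)"
  proof (rule bdd_belowI2)
    fix y assume "y \<in> D"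
    then have "Re (f y) \<le> K * norm y"
      using bound complex_Re_le_cmod order_trans by blast
    moreover have "0 \<le> (norm y - K)\<^sup>2" by simp
    ultimately show "- K\<^sup>2 \<le> J y"
      unfolding J_def by (simp add: power2_diff mult.commute)
  qed
  have lower: "m \<le> J y" if "y \<in> D" for y
    unfolding m_def using bdd that by (intro cInf_lower) auto
  have "\<exists>y\<in>D. J y < m + 1 / (real n + 1)" for n
  proof -
    have "J ` D \<noteq> {}" using sub(3) by auto
    then show ?thesis
      using cInf_lessD[of "J ` D" "m + 1 / (real n + 1)"] by (auto simp: m_def)
  qed
  then obtain y where yD: "\<And>n. y n \<in> D" and yJ: "\<And>n. J (y n) < m + 1 / (real n + 1)"
    by metis
  \<comment> \<open>The parallelogram identity turns near-minimality of two vectors, and minimality at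
    their midpoint, into closeness.\<close>
  have close: "(norm (y n - y k))\<^sup>2 \<le> 2 / (real n + 1) + 2 / (real k + 1)" for n k
  proof -
    have "m \<le> J ((1/2) *\<^sub>R (y n + y k))"
      by (intro lower subR sub yD)
    moreover have "4 * J ((1/2) *\<^sub>R (y n + y k)) = (norm (y n + y k))\<^sup>2 - 4 * Re (f (y n) + f (y k))"
      unfolding J_def fR[OF sub(1)[OF yD yD]] add[OF yD yD] norm_scaleR
      by (simp add: power_mult_distrib power2_eq_square add_divide_distrib)
    ultimately have "(norm (y n - y k))\<^sup>2 \<le> 2 * J (y n) + 2 * J (y k) - 4 * m"
      unfolding norm_diff_square norm_add_square J_def by simp
    then show ?thesis
      using yJ[of n] yJ[of k] by simp
  qed
  have "Cauchy y"
  proof (rule metric_CauchyI)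
    fix e :: real assume e: "0 < e"
    obtain M where M: "4 / e\<^sup>2 < real M"
      using reals_Archimedean2 by blast
    have "dist (y n) (y k) < e" if "M \<le> n" "M \<le> k" for n k
    proof -
      have small: "2 / (real j + 1) < e\<^sup>2 / 2" if "M \<le> j" for j
      proof -
        have "4 < real M * e\<^sup>2"
          using M e by (simp add: divide_simps)
        also have "\<dots> \<le> (real j + 1) * e\<^sup>2"
          using that by (intro mult_right_mono) auto
        finally show ?thesis by (simp add: divide_simps mult.commute)
      qed
      have "(norm (y n - y k))\<^sup>2 < e\<^sup>2"
        using close[of n k] small[OF that(1)] small[OF that(2)] by simp
      then show ?thesis
        using e by (simp add: dist_norm power2_less_imp_less)
    qed
    then show "\<exists>M. \<forall>m\<ge>M. \<forall>n\<ge>M. dist (y m) (y n) < e" by blast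
  qed
  then obtain z where z: "y \<longlonglongrightarrow> z"
    using Cauchy_convergent convergent_def by blast
  have zD: "z \<in> closure D"
    using z yD closure_sequential by blast
  have Re_eq: "Re (cinner z x) = Re (f x)" if x: "x \<in> D" for x
  proof -
    define d where "d = Re (cinner z x) - Re (f x)"
    have "0 \<le> 2 * t * d + t\<^sup>2 * (norm x)\<^sup>2" for t :: real
    proof (rule LIMSEQ_le_const)
      show "(\<lambda>n. 1 / (real n + 1) + (2 * t * (Re (cinner (y n) x) - Re (f x)) + t\<^sup>2 * (norm x)\<^sup>2))
          \<longlonglongrightarrow> (2 * t * d + t\<^sup>2 * (norm x)\<^sup>2)"
      proof -
        have "(\<lambda>n. 1 / (real n + 1)) \<longlonglongrightarrow> 0"
          using LIMSEQ_inverse_real_of_nat by (simp add: inverse_eq_divide add.commute)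
        moreover have "(\<lambda>n. 2 * t * (Re (cinner (y n) x) - Re (f x)) + t\<^sup>2 * (norm x)\<^sup>2)
            \<longlonglongrightarrow> 2 * t * d + t\<^sup>2 * (norm x)\<^sup>2"
          unfolding d_def by (intro tendsto_intros cinner.tendsto z)
        ultimately show ?thesis
          using tendsto_add by fastforce
      qed
      have "0 \<le> 1 / (real n + 1) + (2 * t * (Re (cinner (y n) x) - Re (f x)) + t\<^sup>2 * (norm x)\<^sup>2)" for n
      proof -
        have "m \<le> J (y n + t *\<^sub>R x)"
          by (intro lower sub subR yD x)
        also have "\<dots> = J (y n) + (2 * t * (Re (cinner (y n) x) - Re (f x)) + t\<^sup>2 * (norm x)\<^sup>2)"
          unfolding J_def norm_add_square using yD[of n] x
          by (simp add: add fR subR cinner.scaleR_right power_mult_distrib algebra_simps)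
        finally show ?thesis using yJ[of n] by simp
      qed
      then show "\<exists>N. \<forall>n\<ge>N. 0 \<le> 1 / (real n + 1) + (2 * t * (Re (cinner (y n) x) - Re (f x)) + t\<^sup>2 * (norm x)\<^sup>2)"
        by blast
    qed note quad = this
    have "d = 0"
    proof (cases "x = 0")
      case True
      then show ?thesis using scale[OF x, of 0] by (simp add: d_def)
    next
      case False
      \<comment> \<open>The value of the quadratic polynomial at its minimiser.\<close>
      have "0 \<le> - (d / norm x)\<^sup>2"
        using quad[of "- d / (norm x)\<^sup>2"] False by (simp add: power2_eq_square field_simps)
      then show ?thesis using False by simp
    qed
    then show ?thesis by (simp add: d_def)
  qed
  have rep: "f x = cinner x z" if x: "x \<in> D" for x
  proof (rule complex_eqI)
    show "Re (f x) = Re (cinner x z)"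
      using Re_eq[OF x] cinner_commute[of x z] by simp
    show "Im (f x) = Im (cinner x z)"
      using Re_eq[of "\<i> *\<^sub>C x"] x cinner_commute[of x z]
      by (simp add: sub scale cinner_scaleC_right)
  qed
  have "norm z * norm z \<le> K * norm z"
  proof (rule LIMSEQ_le)
    have "(\<lambda>n. cmod (cinner (y n) z)) \<longlonglongrightarrow> cmod (cinner z z)"
      by (intro tendsto_intros cinner.tendsto z)
    then show "(\<lambda>n. cmod (cinner (y n) z)) \<longlonglongrightarrow> norm z * norm z"
      by (simp add: cinner_norm norm_power power2_eq_square norm_mult)
    show "(\<lambda>n. K * norm (y n)) \<longlonglongrightarrow> K * norm z"
      by (intro tendsto_intros z)
    show "\<exists>N. \<forall>n\<ge>N. cmod (cinner (y n) z) \<le> K * norm (y n)"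
      using bound rep yD by metis
  qed
  then have "norm z \<le> K"
    using K by (cases "norm z = 0") auto
  then show ?thesis
    using zD rep by blast
qed

text \<open>Representing \<open>\<langle>\<cdot>|v\<rangle>\<close> on \<open>V\<close> by a vector \<open>z\<close> of the closure projects \<open>v\<close>: the difference \<open>v - z\<close> is
orthogonal to \<open>V\<close>, hence zero.\<close>

lemma dense_if_orth_compl_trivial:
  fixes V :: "'a::complex_hilbert_space set"
  assumes V: "complex_vector.subspace V" and orth: "orth_compl V \<subseteq> {0}"
  shows "closure V = UNIV"
proof -
  have "v \<in> closure V" for v
  proof -
    have "\<exists>z\<in>closure V. norm z \<le> norm v \<and> (\<forall>y\<in>V. cinner y v = cinner y z)"
      using cauchy_schwarz[of _ v]
      by (intro riesz_on_subspace V) (auto simp: cinner_algebra mult.commute)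
    then obtain z where z: "z \<in> closure V" "\<And>y. y \<in> V \<Longrightarrow> cinner y v = cinner y z"
      by blast
    have "v - z \<in> orth_compl V"
      by (simp add: orth_compl_def cinner_diff_right z(2))
    then show ?thesis using orth z(1) by auto
  qed
  then show ?thesis by blast
qed

lemma eq_if_cinner_eq_on_dense:
  fixes D :: "'a::complex_hilbert_space set"
  assumes "closure D = UNIV" and eq: "\<And>y. y \<in> D \<Longrightarrow> cinner y u = cinner y v"
  shows "u = v"
proof -
  have "u - v \<in> closure D" using assms(1) by simp
  then obtain y where y: "\<And>n. y n \<in> D" "y \<longlonglongrightarrow> u - v"
    unfolding closure_sequential by blast
  have "(\<lambda>n. cinner (y n) (u - v)) \<longlonglongrightarrow> cinner (u - v) (u - v)"
    by (intro cinner.tendsto y tendsto_const)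
  moreover have "cinner (y n) (u - v) = 0" for n
    using eq[OF y(1)] by (simp add: cinner_diff_right)
  ultimately have "(\<lambda>n::nat. 0) \<longlonglongrightarrow> cinner (u - v) (u - v)"
    by simp
  then have "0 = cinner (u - v) (u - v)"
    by (intro LIMSEQ_unique[OF tendsto_const])
  then show ?thesis by (simp add: cinner_norm)
qed

section \<open>Linear maps bounded from below\<close>

text \<open>The linear map is a total function of which only the values on \<open>D\<close> matter; sums and multiples are
then ordinary functions, without the bookkeeping of partial maps.\<close>

definition clinear_on :: "'a::complex_hilbert_space set \<Rightarrow> ('a \<Rightarrow> 'a) \<Rightarrow> bool" where
  "clinear_on D F \<longleftrightarrow> complex_vector.subspace D \<and>
     (\<forall>x\<in>D. \<forall>y\<in>D. F (x + y) = F x + F y) \<and> (\<forall>c. \<forall>x\<in>D. F (c *\<^sub>C x) = c *\<^sub>C F x)"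

lemma clinear_onD:
  assumes "clinear_on D F"
  shows "0 \<in> D" "F 0 = 0"
    and "\<And>x y. x \<in> D \<Longrightarrow> y \<in> D \<Longrightarrow> x + y \<in> D"
    and "\<And>x y. x \<in> D \<Longrightarrow> y \<in> D \<Longrightarrow> F (x + y) = F x + F y"
    and "\<And>x y. x \<in> D \<Longrightarrow> y \<in> D \<Longrightarrow> x - y \<in> D"
    and "\<And>x y. x \<in> D \<Longrightarrow> y \<in> D \<Longrightarrow> F (x - y) = F x - F y"
    and "\<And>c x. x \<in> D \<Longrightarrow> c *\<^sub>C x \<in> D"
    and "\<And>c x. x \<in> D \<Longrightarrow> F (c *\<^sub>C x) = c *\<^sub>C F x"
proof -
  have D: "complex_vector.subspace D"
    and add: "\<And>x y. x \<in> D \<Longrightarrow> y \<in> D \<Longrightarrow> F (x + y) = F x + F y"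
    and scale: "\<And>c x. x \<in> D \<Longrightarrow> F (c *\<^sub>C x) = c *\<^sub>C F x"
    using assms by (auto simp: clinear_on_def)
  note sub = complex_vector.subspace_add[OF D] complex_vector.subspace_scale[OF D]
    complex_vector.subspace_0[OF D] complex_vector.subspace_diff[OF D]
  show "0 \<in> D" "\<And>x y. x \<in> D \<Longrightarrow> y \<in> D \<Longrightarrow> x + y \<in> D"
    "\<And>x y. x \<in> D \<Longrightarrow> y \<in> D \<Longrightarrow> x - y \<in> D" "\<And>c x. x \<in> D \<Longrightarrow> c *\<^sub>C x \<in> D"
    by (simp_all add: sub)
  show "\<And>x y. x \<in> D \<Longrightarrow> y \<in> D \<Longrightarrow> F (x + y) = F x + F y"
    "\<And>c x. x \<in> D \<Longrightarrow> F (c *\<^sub>C x) = c *\<^sub>C F x"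
    by (fact add, fact scale)
  show "F 0 = 0" using scale[OF sub(3), of 0] by simp
  show "F (x - y) = F x - F y" if "x \<in> D" "y \<in> D" for x y
    using add[of "x - y" y] that sub(4) by (simp add: algebra_simps)
qed

lemma clinear_on_add:
  assumes "clinear_on D F" "clinear_on UNIV G"
  shows "clinear_on D (\<lambda>x. F x + G x)"
  using assms by (auto simp: clinear_on_def scaleC_add_right)

lemma clinear_on_scaleC: "clinear_on D F \<Longrightarrow> clinear_on D (\<lambda>x. c *\<^sub>C F x)"
  by (auto simp: clinear_on_def scaleC_add_right scaleC_scaleC mult.commute)

lemma clinear_on_scalar: "clinear_on UNIV (\<lambda>x::'a::complex_hilbert_space. c *\<^sub>C x)"
  by (auto simp: clinear_on_def scaleC_add_right scaleC_scaleC mult.commute)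

lemma clinear_on_shift:
  assumes "clinear_on D F"
  shows "clinear_on D (\<lambda>x. F x - c *\<^sub>C x)"
  using clinear_on_add[OF assms clinear_on_scalar[of "- c"]] by simp

lemma subspace_image:
  assumes "clinear_on D F"
  shows "complex_vector.subspace (F ` D)"
proof (rule complex_vector.subspaceI)
  note L = clinear_onD[OF assms]
  show "0 \<in> F ` D" using L(1,2) by (metis imageI)
  show "x + y \<in> F ` D" if "x \<in> F ` D" "y \<in> F ` D" for x y
    using that L(3,4) by (metis (no_types, lifting) imageE imageI)
  show "c *\<^sub>C x \<in> F ` D" if "x \<in> F ` D" for c x
    using that L(7,8) by (metis (no_types, lifting) imageE imageI)
qed

text \<open>To solve \<open>L x + P x = y\<close>, iterate \<open>x \<mapsto> L\<^sup>-\<^sup>1 (y - P x)\<close>: since \<open>L\<^sup>-\<^sup>1\<close> has norm at most \<open>1 / d\<close>, this is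
a contraction with constant \<open>q / d\<close>.\<close>

lemma surj_perturb:
  fixes D :: "'a::complex_hilbert_space set"
  assumes L: "clinear_on D L" and surj: "L ` D = UNIV"
    and below: "\<And>x. x \<in> D \<Longrightarrow> d * norm x \<le> norm (L x)"
    and P: "clinear_on UNIV P" and bound: "\<And>x. norm (P x) \<le> q * norm x"
    and q: "0 \<le> q" "q < d"
  shows "(\<lambda>x. L x + P x) ` D = UNIV"
proof -
  define R where "R = inv_into D L"
  have R: "R z \<in> D" "L (R z) = z" for z
    using surj by (auto simp: R_def inv_into_into f_inv_into_f)
  have "y \<in> (\<lambda>x. L x + P x) ` D" for y
  proof -
    have contr: "dist (R (y - P x)) (R (y - P x')) \<le> (q / d) * dist x x'" for x x'
    proof -
      have "d * norm (R (y - P x) - R (y - P x')) \<le> norm (L (R (y - P x) - R (y - P x')))"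
        by (intro below clinear_onD[OF L] R)
      also have "L (R (y - P x) - R (y - P x')) = P (x' - x)"
        by (simp add: clinear_onD[OF L] R clinear_onD[OF P])
      also have "norm \<dots> \<le> q * norm (x' - x)"
        by (rule bound)
      finally show ?thesis
        using q by (simp add: dist_norm norm_minus_commute field_simps)
    qed
    have "\<exists>!x. R (y - P x) = x"
      using q contr by (intro banach_fix_type[where c = "q / d"]) auto
    then obtain x where "R (y - P x) = x" by auto
    then have "x \<in> D" "L x = y - P x"
      using R by metis+
    then show ?thesis by (intro image_eqI[of _ _ x]) auto
  qed
  then show ?thesis by blast
qed

text \<open>The lower bound turns convergence of the images \<open>F x\<^sub>n - c x\<^sub>n\<close> into the Cauchy property of \<open>x\<^sub>n\<close>, and
then \<open>F x\<^sub>n\<close> converges as well, so that the closed graph applies.\<close>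

lemma closed_range_if_closed_graph:
  fixes D :: "'a::complex_hilbert_space set"
  assumes F: "clinear_on D F" and cl: "closed ((\<lambda>x. (x, F x)) ` D)"
    and below: "\<And>x. x \<in> D \<Longrightarrow> d * norm x \<le> norm (F x - c *\<^sub>C x)" and d: "0 < d"
  shows "closed ((\<lambda>x. F x - c *\<^sub>C x) ` D)"
  unfolding closed_sequential_limits
proof (intro allI impI, elim conjE)
  fix s l assume s: "\<forall>n. s n \<in> (\<lambda>x. F x - c *\<^sub>C x) ` D" and lim: "s \<longlonglongrightarrow> l"
  have "\<forall>n. \<exists>x. x \<in> D \<and> s n = F x - c *\<^sub>C x"
    using s by auto
  then obtain x where xD: "\<And>n. x n \<in> D" and sx: "\<And>n. s n = F (x n) - c *\<^sub>C x n"
    by (auto dest!: choice)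
  have below': "d * norm (x m - x n) \<le> norm (s m - s n)" for m n
  proof -
    have "s m - s n = F (x m - x n) - c *\<^sub>C (x m - x n)"
      unfolding clinear_onD(6)[OF F xD xD] sx complex_vector.scale_right_diff_distrib by simp
    then show ?thesis
      using below[of "x m - x n"] by (simp add: clinear_onD[OF F] xD)
  qed
  have "Cauchy x"
  proof (rule metric_CauchyI)
    fix e :: real assume e: "0 < e"
    obtain M where M: "\<And>m n. M \<le> m \<Longrightarrow> M \<le> n \<Longrightarrow> dist (s m) (s n) < d * e"
      using metric_CauchyD[OF LIMSEQ_imp_Cauchy[OF lim], of "d * e"] e d by auto
    have "dist (x m) (x n) < e" if "M \<le> m" "M \<le> n" for m n
    proof -
      have "d * norm (x m - x n) < d * e"
        using below'[of m n] M[OF that] by (simp add: dist_norm)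
      then show ?thesis using d by (simp add: dist_norm)
    qed
    then show "\<exists>M. \<forall>m\<ge>M. \<forall>n\<ge>M. dist (x m) (x n) < e" by blast
  qed
  then obtain z where z: "x \<longlonglongrightarrow> z"
    using Cauchy_convergent convergent_def by blast
  have "(\<lambda>n. s n + c *\<^sub>C x n) \<longlonglongrightarrow> l + c *\<^sub>C z"
    by (intro tendsto_intros lim scaleC.tendsto z)
  then have "(\<lambda>n. F (x n)) \<longlonglongrightarrow> l + c *\<^sub>C z"
    by (simp add: sx)
  then have "(\<lambda>n. (x n, F (x n))) \<longlonglongrightarrow> (z, l + c *\<^sub>C z)"
    by (intro tendsto_Pair z)
  then have "(z, l + c *\<^sub>C z) \<in> (\<lambda>x. (x, F x)) ` D"
    by (rule closed_sequentially[OF cl, rotated]) (use xD in auto)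
  then show "l \<in> (\<lambda>x. F x - c *\<^sub>C x) ` D"
    by (auto intro!: image_eqI[of _ _ z] simp: eq_diff_eq)
qed

lemma surj_if_closed_graph:
  fixes D :: "'a::complex_hilbert_space set"
  assumes F: "clinear_on D F" and cl: "closed ((\<lambda>x. (x, F x)) ` D)"
    and below: "\<And>x. x \<in> D \<Longrightarrow> d * norm x \<le> norm (F x - c *\<^sub>C x)" and d: "0 < d"
    and orth: "orth_compl ((\<lambda>x. F x - c *\<^sub>C x) ` D) \<subseteq> {0}"
  shows "(\<lambda>x. F x - c *\<^sub>C x) ` D = UNIV"
  using dense_if_orth_compl_trivial[OF subspace_image[OF clinear_on_shift[OF F]] orth]
    closed_range_if_closed_graph[OF F cl below d] by simp

section \<open>Operators shifted by a point outside the numerical range\<close>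

lemma is_operator_iff: "is_operator T \<longleftrightarrow> clinear_on (dom T) (\<lambda>x. the (T x))"
  by (auto simp: is_operator_def clinear_on_def)

lemma the_op_shift: "x \<in> dom T \<Longrightarrow> the (op_shift T c x) = the (T x) - c *\<^sub>C x"
  by (auto simp: op_shift_def)

lemma ran_op_shift: "ran (op_shift T c) = (\<lambda>x. the (T x) - c *\<^sub>C x) ` dom T"
  by (force simp: ran_def op_shift_def)

lemma graph_eq_image: "Map.graph T = (\<lambda>x. (x, the (T x))) ` dom T"
  by (force simp: Map.graph_def)

lemma rayleigh_quotient_in_numerical_range:
  assumes T: "is_operator T" and x: "x \<in> dom T" "x \<noteq> 0"
  shows "cinner (the (T x)) x / complex_of_real ((norm x)\<^sup>2) \<in> numerical_range T"
proof -
  note L = clinear_onD[OF T[unfolded is_operator_iff]]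
  define e where "e = complex_of_real (1 / norm x) *\<^sub>C x"
  have "norm e = 1" "e \<in> dom T"
    using x L(7)[OF x(1)] by (simp_all add: e_def norm_scaleC norm_divide)
  moreover have "cinner (the (T e)) e = cinner (the (T x)) x / complex_of_real ((norm x)\<^sup>2)"
    unfolding e_def using L(8)[OF x(1)]
    by (simp add: cinner_scaleC_left cinner_scaleC_right power2_eq_square)
  ultimately show ?thesis
    unfolding numerical_range_def by force
qed

text \<open>The basic resolvent estimate.  By Cauchy-Schwarz, \<open>\<parallel>(T - c) x\<parallel> \<parallel>x\<parallel>\<close> dominates
\<open>\<bar>\<langle>T x|x\<rangle> - c \<parallel>x\<parallel>\<^sup>2\<bar>\<close>, which is \<open>\<parallel>x\<parallel>\<^sup>2\<close> times the distance from \<open>c\<close> to the Rayleigh quotient of \<open>x\<close>.\<close>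

lemma numerical_range_lower_bound:
  assumes T: "is_operator T" and nr: "numerical_range T \<subseteq> S" and x: "x \<in> dom T"
  shows "infdist c S * norm x \<le> norm (the (T x) - c *\<^sub>C x)"
proof (cases "x = 0")
  case False
  define n where "n = complex_of_real ((norm x)\<^sup>2)"
  have n: "n \<noteq> 0" "cmod n = norm x * norm x"
    using False by (simp_all add: n_def norm_mult power2_eq_square)
  have "infdist c S \<le> dist c (cinner (the (T x)) x / n)"
    using rayleigh_quotient_in_numerical_range[OF T x False] nr
    unfolding n_def by (intro infdist_le) auto
  also have "dist c (cinner (the (T x)) x / n) = cmod ((cinner (the (T x)) x - c * n) / n)"
    using n(1) by (simp add: dist_norm norm_minus_commute diff_divide_distrib)
  also have "cinner (the (T x)) x - c * n = cinner (the (T x) - c *\<^sub>C x) x"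
    by (simp add: cinner_diff_left cinner_scaleC_left cinner_norm n_def)
  also have "cmod (cinner (the (T x) - c *\<^sub>C x) x / n) \<le>
      norm (the (T x) - c *\<^sub>C x) * norm x / (norm x * norm x)"
    unfolding norm_divide n(2) by (intro divide_right_mono cauchy_schwarz) simp
  finally show ?thesis
    using False by (simp add: field_simps)
qed simp

lemma infdist_pos:
  assumes "closed S" "S \<noteq> {}" "c \<notin> S"
  shows "0 < infdist c S"
  using assms in_closed_iff_infdist_zero[of S c] infdist_nonneg[of c S] by linarith

text \<open>\<open>T - c'\<close> differs from \<open>T - c\<close> by a multiple of the identity that is smaller than the lower bound of
\<open>T - c\<close>.\<close>

lemma surjective_shift_locally_constant:
  assumes T: "is_operator T" and nr: "numerical_range T \<subseteq> S"
    and surj: "ran (op_shift T c) = UNIV" and near: "dist c c' < infdist c S"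
  shows "ran (op_shift T c') = UNIV"
proof -
  have "(\<lambda>x. (the (T x) - c *\<^sub>C x) + (c - c') *\<^sub>C x) ` dom T = UNIV"
  proof (rule surj_perturb)
    show "clinear_on (dom T) (\<lambda>x. the (T x) - c *\<^sub>C x)"
      using T clinear_on_shift unfolding is_operator_iff by blast
    show "clinear_on UNIV (\<lambda>x::'a. (c - c') *\<^sub>C x)"
      by (rule clinear_on_scalar)
    show "norm ((c - c') *\<^sub>C x) \<le> dist c c' * norm x" for x :: 'a
      by (simp add: norm_scaleC dist_norm)
  qed (use surj near numerical_range_lower_bound[OF T nr] in \<open>auto simp: ran_op_shift\<close>)
  then show ?thesis
    by (simp add: ran_op_shift complex_vector.scale_left_diff_distrib)
qed

text \<open>The radius within which surjectivity persists is the full distance to \<open>S\<close>, so it is bounded away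
from zero near every point of \<open>C\<close>.  Surjectivity is therefore a closed as well as an open condition in \<open>C\<close>.\<close>

lemma surjective_shift_on_connected:
  assumes T: "is_operator T" and nr: "numerical_range T \<subseteq> S"
    and S: "closed S" "S \<noteq> {}" and C: "connected C" "C \<subseteq> - S"
    and c: "c \<in> C" "ran (op_shift T c) = UNIV" and c': "c' \<in> C"
  shows "ran (op_shift T c') = UNIV"
proof (rule connected_induction_simple[where P = "\<lambda>c. ran (op_shift T c) = UNIV",
      OF C(1) c(1) c' c(2)])
  fix a assume a: "a \<in> C"
  define r where "r = infdist a S"
  have r: "0 < r"
    unfolding r_def using infdist_pos[OF S] a C(2) by blast
  \<comment> \<open>Two points of this ball are less than \<open>2 r / 3\<close> apart, and both are farther than that from \<open>S\<close>.\<close>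
  have step: "ran (op_shift T y) = UNIV"
    if "x \<in> C \<inter> ball a (r / 3)" "y \<in> C \<inter> ball a (r / 3)" "ran (op_shift T x) = UNIV" for x y
  proof (rule surjective_shift_locally_constant[OF T nr that(3)])
    have "dist x y < r - dist a x"
      using that(1,2) dist_triangle[of x y a] r by (simp add: dist_commute)
    also have "\<dots> \<le> infdist x S"
      using infdist_triangle[of a S x] by (simp add: r_def)
    finally show "dist x y < infdist x S" .
  qed
  show "\<exists>U. openin (top_of_set C) U \<and> a \<in> U \<and>
      (\<forall>x\<in>U. \<forall>y\<in>U. ran (op_shift T x) = UNIV \<longrightarrow> ran (op_shift T y) = UNIV)"
  proof (intro exI[of _ "C \<inter> ball a (r / 3)"] conjI ballI impI)
    show "openin (top_of_set C) (C \<inter> ball a (r / 3))" by (simp add: openin_open_Int)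
    show "a \<in> C \<inter> ball a (r / 3)" using a r by simp
  qed (rule step)
qed

lemma resolvent_set_iff_surjective:
  assumes T: "is_operator T" and nr: "numerical_range T \<subseteq> S" and S: "closed S" "S \<noteq> {}" "c \<notin> S"
  shows "c \<in> resolvent_set T \<longleftrightarrow> ran (op_shift T c) = UNIV"
proof
  have im: "(\<lambda>x. the (op_shift T c x)) ` dom T = ran (op_shift T c)"
    by (auto simp: ran_op_shift the_op_shift intro!: image_cong)
  show "ran (op_shift T c) = UNIV" if "c \<in> resolvent_set T"
    using that im by (simp add: resolvent_set_def bij_betw_def Let_def)
  assume surj: "ran (op_shift T c) = UNIV"
  define d where "d = infdist c S"
  have d: "0 < d" unfolding d_def by (rule infdist_pos[OF S])
  define f where "f x = the (op_shift T c x)" for x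
  have f: "f x = the (T x) - c *\<^sub>C x" if "x \<in> dom T" for x
    using that by (simp add: f_def the_op_shift)
  have below: "d * norm x \<le> norm (f x)" if "x \<in> dom T" for x
    using numerical_range_lower_bound[OF T nr that] by (simp add: d_def f that)
  have lin: "clinear_on (dom T) (\<lambda>x. the (T x) - c *\<^sub>C x)"
    using T clinear_on_shift unfolding is_operator_iff by blast
  have inj: "inj_on f (dom T)"
  proof (rule inj_onI)
    fix x y assume xy: "x \<in> dom T" "y \<in> dom T" "f x = f y"
    note m = clinear_onD(5,6)[OF lin xy(1,2)]
    have "d * norm (x - y) \<le> 0"
      using below[OF m(1)] f[OF m(1)] m(2) f[OF xy(1)] f[OF xy(2)] xy(3) by simp
    then show "x = y" using d by (simp add: mult_le_0_iff)
  qed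
  have "norm (the_inv_into (dom T) f y) \<le> (1 / d) * norm y" for y
  proof -
    have y: "y \<in> f ` dom T" using im surj by (simp add: f_def)
    show ?thesis
      using below[OF the_inv_into_into[OF inj y order_refl]] f_the_inv_into_f[OF inj y] d
      by (simp add: field_simps)
  qed
  then have "\<exists>K. \<forall>y. norm (the_inv_into (dom T) f y) \<le> K * norm y" by blast
  moreover have "bij_betw f (dom T) UNIV"
    using inj im surj by (simp add: bij_betw_def f_def)
  ultimately show "c \<in> resolvent_set T"
    unfolding resolvent_set_def f_def by (simp add: Let_def)
qed

text \<open>If \<open>x\<^sub>n\<close> and \<open>T x\<^sub>n\<close> converge to \<open>x\<close> and \<open>y\<close>, solve \<open>(T - c) z = y - c x\<close>.  The lower bound,
applied to \<open>x\<^sub>n - z\<close>, forces \<open>x\<^sub>n \<longlonglongrightarrow> z\<close>, hence \<open>z = x\<close> and \<open>T x = y\<close>.\<close>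

lemma closed_if_surjective_shift:
  assumes T: "is_operator T" and nr: "numerical_range T \<subseteq> S" and S: "closed S" "S \<noteq> {}" "c \<notin> S"
    and surj: "ran (op_shift T c) = UNIV"
  shows "closed_operator T"
  unfolding closed_operator_def graph_eq_image closed_sequential_limits
proof (intro allI impI, elim conjE)
  note L = clinear_onD[OF clinear_on_shift[OF T[unfolded is_operator_iff], of c]]
  fix s l assume s: "\<forall>n. s n \<in> (\<lambda>x. (x, the (T x))) ` dom T" and lim: "s \<longlonglongrightarrow> l"
  define x where "x n = fst (s n)" for n
  have xD: "x n \<in> dom T" and snd_s: "snd (s n) = the (T (x n))" for n
    using s[rule_format, of n] by (auto simp: x_def)
  have x: "x \<longlonglongrightarrow> fst l" and Tx: "(\<lambda>n. the (T (x n))) \<longlonglongrightarrow> snd l"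
    using tendsto_fst[OF lim] tendsto_snd[OF lim] by (simp_all add: x_def[abs_def] snd_s[unfolded x_def])
  obtain z where z: "z \<in> dom T" "the (T z) - c *\<^sub>C z = snd l - c *\<^sub>C fst l"
    using surj unfolding ran_op_shift by (metis (no_types, lifting) UNIV_I imageE)
  define d where "d = infdist c S"
  have d: "0 < d" unfolding d_def by (rule infdist_pos[OF S])
  have "(\<lambda>n. x n - z) \<longlonglongrightarrow> 0"
  proof (rule Lim_null_comparison)
    have "d * norm (x n - z) \<le> norm ((the (T (x n)) - c *\<^sub>C x n) - (snd l - c *\<^sub>C fst l))" for n
      using numerical_range_lower_bound[OF T nr L(5)[OF xD z(1)], of c] L(6)[OF xD z(1)] z(2)
      by (simp add: d_def)
    then show "\<forall>\<^sub>F n in sequentially. norm (x n - z) \<le>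
        norm ((the (T (x n)) - c *\<^sub>C x n) - (snd l - c *\<^sub>C fst l)) / d"
      using d by (intro always_eventually) (simp add: field_simps)
    have "(\<lambda>n. norm ((the (T (x n)) - c *\<^sub>C x n) - (snd l - c *\<^sub>C fst l)) / d) \<longlonglongrightarrow>
        norm ((snd l - c *\<^sub>C fst l) - (snd l - c *\<^sub>C fst l)) / d"
      by (intro tendsto_intros scaleC.tendsto x Tx) (use d in simp)
    then show "(\<lambda>n. norm ((the (T (x n)) - c *\<^sub>C x n) - (snd l - c *\<^sub>C fst l)) / d) \<longlonglongrightarrow> 0"
      by simp
  qed
  then have "x \<longlonglongrightarrow> z" by (simp add: LIM_zero_iff)
  then have "fst l = z" using x LIMSEQ_unique by blast
  moreover from this z have "snd l = the (T z)" by simp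
  ultimately have "l = (z, the (T z))" by (simp add: prod_eq_iff)
  then show "l \<in> (\<lambda>x. (x, the (T x))) ` dom T" using z(1) by blast
qed

text \<open>A vector orthogonal to the domain has the form \<open>(T - c) x\<close>, and orthogonality to \<open>x\<close> itself gives
\<open>\<langle>T x|x\<rangle> = c \<parallel>x\<parallel>\<^sup>2\<close>.  As \<open>c\<close> lies outside \<open>S\<close>, this is possible only for \<open>x = 0\<close>.\<close>

lemma densely_defined_if_surjective_shift:
  assumes T: "is_operator T" and nr: "numerical_range T \<subseteq> S" and S: "closed S" "S \<noteq> {}" "c \<notin> S"
    and surj: "ran (op_shift T c) = UNIV"
  shows "densely_defined T"
  unfolding densely_defined_def
proof (rule dense_if_orth_compl_trivial)
  show "complex_vector.subspace (dom T)" using T by (simp add: is_operator_def)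
  show "orth_compl (dom T) \<subseteq> {0}"
  proof
    fix y assume y: "y \<in> orth_compl (dom T)"
    obtain x where x: "x \<in> dom T" "y = the (T x) - c *\<^sub>C x"
      using surj unfolding ran_op_shift by (metis (no_types, lifting) UNIV_I imageE)
    have "x = 0"
    proof (rule ccontr)
      assume "x \<noteq> 0"
      have "cinner (the (T x)) x = c * complex_of_real ((norm x)\<^sup>2)"
      proof -
        have "cinner y x = 0"
          using y x(1) cinner_commute[of x y] by (simp add: orth_compl_def)
        then show ?thesis
          by (simp add: x(2) cinner_diff_left cinner_scaleC_left cinner_norm)
      qed
      then have "c \<in> S"
        using rayleigh_quotient_in_numerical_range[OF T x(1) \<open>x \<noteq> 0\<close>] nr \<open>x \<noteq> 0\<close> by auto
      then show False using S(3) by contradiction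
    qed
    then show "y \<in> {0}" using x(2) clinear_onD(2)[OF T[unfolded is_operator_iff]] by simp
  qed
qed

text \<open>The shift of an extension with numerical range in \<open>S\<close> is still injective; the shift of \<open>T\<close> already
takes every value, which leaves no room for new domain vectors.\<close>

lemma maximal_if_surjective_shift:
  assumes T: "is_operator T" and nr: "numerical_range T \<subseteq> S" and S: "closed S" "S \<noteq> {}" "c \<notin> S"
    and surj: "ran (op_shift T c) = UNIV"
  shows "nr_maximal S T"
  unfolding nr_maximal_def
proof (intro conjI nr allI impI, elim conjE)
  fix T' assume T': "is_operator T'" and ext: "T \<subseteq>\<^sub>m T'" and nr': "numerical_range T' \<subseteq> S"
  have agree: "T' x = T x" if "x \<in> dom T" for x
    using ext that by (auto simp: map_le_def)
  have "dom T' \<subseteq> dom T"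
  proof
    fix z assume z: "z \<in> dom T'"
    obtain x where x: "x \<in> dom T" "the (T x) - c *\<^sub>C x = the (T' z) - c *\<^sub>C z"
      using surj unfolding ran_op_shift by (metis (no_types, lifting) UNIV_I imageE)
    have x': "x \<in> dom T'" using x(1) ext map_le_implies_dom_le by blast
    note L = clinear_onD[OF clinear_on_shift[OF T'[unfolded is_operator_iff], of c]]
    have "infdist c S * norm (z - x) \<le> 0"
      using numerical_range_lower_bound[OF T' nr' L(5)[OF z x'], of c] L(6)[OF z x'] x(2)
        agree[OF x(1)] by simp
    then have "z = x" using infdist_pos[OF S] by (simp add: mult_le_0_iff)
    then show "z \<in> dom T" using x(1) by simp
  qed
  then have "T' \<subseteq>\<^sub>m T" using agree by (auto simp: map_le_def)
  then show "T = T'" using ext map_le_antisym by blast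
qed

section \<open>Defect indices\<close>

lemma cdim_eq_0_iff:
  fixes V :: "'a::complex_hilbert_space set"
  shows "cdim V = 0 \<longleftrightarrow> V \<subseteq> {0}"
proof
  assume 0: "cdim V = 0"
  show "V \<subseteq> {0}"
  proof
    fix v assume v: "v \<in> V"
    show "v \<in> {0}"
    proof (rule ccontr)
      assume "v \<notin> {0}"
      then have "complex_vector.independent {v}"
        by (simp add: complex_vector.dependent_single)
      then have "enat (card {v}) \<le> cdim V"
        unfolding cdim_def using v by (intro Sup_upper) blast
      then show False using 0 by (simp add: enat_0_iff)
    qed
  qed
next
  assume V: "V \<subseteq> {0}"
  have "B = {}" if "B \<subseteq> V" "complex_vector.independent B" for B
    using that V complex_vector.dependent_zero[of B] by blast
  then have "cdim V \<le> 0"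
    unfolding cdim_def by (intro Sup_least) (force simp: zero_enat_def)
  then show "cdim V = 0" by simp
qed

text \<open>For a closed operator the range of the shift is closed, so that it is the whole space exactly if its
orthogonal complement is zero.\<close>

lemma closed_surjective_shift_iff_cdim:
  assumes T: "is_operator T" and nr: "numerical_range T \<subseteq> S" and S: "closed S" "S \<noteq> {}" "c \<notin> S"
    and cl: "closed_operator T"
  shows "ran (op_shift T c) = UNIV \<longleftrightarrow> cdim (orth_compl (ran (op_shift T c))) = 0"
proof
  assume "ran (op_shift T c) = UNIV"
  moreover have "y = 0" if "\<forall>x. cinner x y = 0" for y :: 'a
    using that[rule_format, of y] by (simp add: cinner_norm)
  ultimately show "cdim (orth_compl (ran (op_shift T c))) = 0"
    by (auto simp: cdim_eq_0_iff orth_compl_def)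
next
  assume 0: "cdim (orth_compl (ran (op_shift T c))) = 0"
  show "ran (op_shift T c) = UNIV"
    unfolding ran_op_shift
  proof (rule surj_if_closed_graph[OF T[unfolded is_operator_iff] _ _ infdist_pos[OF S]])
    show "closed ((\<lambda>x. (x, the (T x))) ` dom T)"
      using cl by (simp add: closed_operator_def graph_eq_image)
    show "orth_compl ((\<lambda>x. the (T x) - c *\<^sub>C x) ` dom T) \<subseteq> {0}"
      using 0 by (simp add: cdim_eq_0_iff ran_op_shift)
  qed (rule numerical_range_lower_bound[OF T nr])
qed

section \<open>Maximal symmetric operators\<close>

lemma symmetric_lower_bound:
  assumes real: "Im (cinner y x) = 0"
  shows "\<bar>s\<bar> * norm x \<le> norm (y - (\<i> * complex_of_real s) *\<^sub>C (x::'a::complex_hilbert_space))"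
proof (cases "x = 0")
  case False
  have "\<bar>s\<bar> * (norm x * norm x) = \<bar>Im (cinner (y - (\<i> * complex_of_real s) *\<^sub>C x) x)\<bar>"
    using real
    by (simp add: cinner_diff_left cinner_scaleC_left cinner_norm abs_mult power2_eq_square)
  also have "\<dots> \<le> norm (y - (\<i> * complex_of_real s) *\<^sub>C x) * norm x"
    using abs_Im_le_cmod cauchy_schwarz order_trans by blast
  finally show ?thesis using False by simp
qed simp

text \<open>The maximality hypothesis says that a vector \<open>w\<close> of the domain of the adjoint, with \<open>g = A\<^sup>* w\<close>, lies in
\<open>D\<close> as soon as \<open>\<langle>A\<^sup>* w|w\<rangle>\<close> is real: otherwise \<open>A\<close> could be extended to \<open>w\<close>.  Limit points of the graph are
of this kind, so \<open>A\<close> is closed.  If neither range were the whole space, there would be unit vectors with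
\<open>A\<^sup>* u = - \<i> k u\<close> and \<open>A\<^sup>* v = \<i> k v\<close>.  Then \<open>u + v\<close> and \<open>u - v\<close> are also of this kind, which puts the
eigenvector \<open>u\<close> of a nonreal eigenvalue into the domain of the symmetric operator \<open>A\<close>.\<close>

lemma maximal_symmetric_surjective:
  fixes D :: "'a::complex_hilbert_space set"
  assumes A: "clinear_on D A" and dense: "closure D = UNIV"
    and sym: "\<And>x y. x \<in> D \<Longrightarrow> y \<in> D \<Longrightarrow> cinner (A x) y = cinner x (A y)"
    and max: "\<And>w g. (\<And>x. x \<in> D \<Longrightarrow> cinner (A x) w = cinner x g) \<Longrightarrow> Im (cinner g w) = 0 \<Longrightarrow> w \<in> D"
    and k: "0 < k"
  shows "\<exists>s\<in>{k, -k}. (\<lambda>x. A x - (\<i> * complex_of_real s) *\<^sub>C x) ` D = UNIV"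
proof -
  note L = clinear_onD[OF A]
  have real: "Im (cinner (A x) x) = 0" if "x \<in> D" for x
    using sym[OF that that] cinner_commute[of x "A x"] by (simp add: complex_eq_iff)
  have A_eq: "w \<in> D \<and> A w = g"
    if adj: "\<And>x. x \<in> D \<Longrightarrow> cinner (A x) w = cinner x g" and Im: "Im (cinner g w) = 0" for w g
  proof -
    have w: "w \<in> D" using max[OF adj Im] .
    have "cinner x (A w) = cinner x g" if "x \<in> D" for x
      using sym[OF that w] adj[OF that] by simp
    then show ?thesis using w eq_if_cinner_eq_on_dense[OF dense] by blast
  qed
  have graph: "closed ((\<lambda>x. (x, A x)) ` D)"
    unfolding closed_sequential_limits
  proof (intro allI impI, elim conjE)
    fix s l assume s: "\<forall>n. s n \<in> (\<lambda>x. (x, A x)) ` D" and lim: "s \<longlonglongrightarrow> l"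
    define x where "x n = fst (s n)" for n
    have xD: "x n \<in> D" and snd_s: "snd (s n) = A (x n)" for n
      using s[rule_format, of n] by (auto simp: x_def)
    have x: "x \<longlonglongrightarrow> fst l" and Ax: "(\<lambda>n. A (x n)) \<longlonglongrightarrow> snd l"
      using tendsto_fst[OF lim] tendsto_snd[OF lim]
      by (simp_all add: x_def[abs_def] snd_s[unfolded x_def])
    have "fst l \<in> D \<and> A (fst l) = snd l"
    proof (rule A_eq)
      fix z assume z: "z \<in> D"
      have "(\<lambda>n. cinner (A z) (x n)) \<longlonglongrightarrow> cinner (A z) (fst l)"
        by (intro cinner.tendsto tendsto_const x)
      moreover have "(\<lambda>n. cinner (A z) (x n)) \<longlonglongrightarrow> cinner z (snd l)"
        unfolding sym[OF z xD] by (intro cinner.tendsto tendsto_const Ax)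
      ultimately show "cinner (A z) (fst l) = cinner z (snd l)"
        by (rule LIMSEQ_unique)
    next
      have "(\<lambda>n. Im (cinner (A (x n)) (x n))) \<longlonglongrightarrow> Im (cinner (snd l) (fst l))"
        by (intro tendsto_Im cinner.tendsto x Ax)
      then have "(\<lambda>n::nat. 0) \<longlonglongrightarrow> Im (cinner (snd l) (fst l))"
        by (simp add: real[OF xD])
      then show "Im (cinner (snd l) (fst l)) = 0"
        using LIMSEQ_unique[OF tendsto_const] by metis
    qed
    then show "l \<in> (\<lambda>x. (x, A x)) ` D"
      by (intro image_eqI[of _ _ "fst l"]) (auto simp: prod_eq_iff)
  qed
  have defect: "\<exists>u. norm u = 1 \<and> (\<forall>x\<in>D. cinner (A x) u = cinner x ((- \<i> * complex_of_real s) *\<^sub>C u))"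
    if s: "s \<noteq> 0" "(\<lambda>x. A x - (\<i> * complex_of_real s) *\<^sub>C x) ` D \<noteq> UNIV" for s
  proof -
    have "\<not> orth_compl ((\<lambda>x. A x - (\<i> * complex_of_real s) *\<^sub>C x) ` D) \<subseteq> {0}"
      using surj_if_closed_graph[OF A graph, of "\<bar>s\<bar>" "\<i> * complex_of_real s"]
        symmetric_lower_bound[OF real] s by auto
    then obtain v where v: "v \<noteq> 0" "\<And>x. x \<in> D \<Longrightarrow> cinner (A x - (\<i> * complex_of_real s) *\<^sub>C x) v = 0"
      by (auto simp: orth_compl_def)
    show ?thesis
    proof (intro exI[of _ "complex_of_real (1 / norm v) *\<^sub>C v"] conjI ballI)
      show "norm (complex_of_real (1 / norm v) *\<^sub>C v) = 1"
        using v(1) by (simp add: norm_scaleC norm_divide)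
      fix x assume "x \<in> D"
      then have "cinner (A x) v = \<i> * complex_of_real s * cinner x v"
        using v(2) by (simp add: cinner_diff_left cinner_scaleC_left)
      then show "cinner (A x) (complex_of_real (1 / norm v) *\<^sub>C v)
          = cinner x ((- \<i> * complex_of_real s) *\<^sub>C complex_of_real (1 / norm v) *\<^sub>C v)"
        by (simp add: cinner_scaleC_right cinner_minus_right)
    qed
  qed
  show ?thesis
  proof (rule ccontr)
    assume "\<not> ?thesis"
    then have "(\<lambda>x. A x - (\<i> * complex_of_real k) *\<^sub>C x) ` D \<noteq> UNIV"
      and "(\<lambda>x. A x - (\<i> * complex_of_real (- k)) *\<^sub>C x) ` D \<noteq> UNIV"
      by blast+
    from defect[OF _ this(1)] defect[OF _ this(2)] k
    obtain u v where u: "norm u = 1" "\<And>x. x \<in> D \<Longrightarrow> cinner (A x) u = cinner x ((- \<i> * complex_of_real k) *\<^sub>C u)"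
      and v: "norm v = 1" "\<And>x. x \<in> D \<Longrightarrow> cinner (A x) v = cinner x ((\<i> * complex_of_real k) *\<^sub>C v)"
      by auto
    define a where "a = \<i> * complex_of_real k"
    \<comment> \<open>The two imaginary contributions cancel because the defect vectors have equal norms,
      and the cross terms form a number plus its conjugate.\<close>
    have mem: "u + t *\<^sub>C v \<in> D \<and> A (u + t *\<^sub>C v) = (- a) *\<^sub>C u + (t * a) *\<^sub>C v"
      if t: "t * cnj t = 1" for t
    proof (rule A_eq)
      show "cinner (A x) (u + t *\<^sub>C v) = cinner x ((- a) *\<^sub>C u + (t * a) *\<^sub>C v)" if "x \<in> D" for x
        using u(2)[OF that] v(2)[OF that]
        by (simp add: cinner_algebra a_def)
      have "cinner ((- a) *\<^sub>C u + (t * a) *\<^sub>C v) (u + t *\<^sub>C v)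
          = a * (t * cinner v u - cnj (t * cinner v u)) + a * (t * cnj t - 1)"
        using cinner_commute[of u v] u(1) v(1)
        by (simp add: cinner_algebra cinner_norm algebra_simps)
      then show "Im (cinner ((- a) *\<^sub>C u + (t * a) *\<^sub>C v) (u + t *\<^sub>C v)) = 0"
        using t by (simp add: a_def)
    qed
    have m1: "u + v \<in> D" "A (u + v) = - (a *\<^sub>C u) + a *\<^sub>C v"
      using mem[of 1] by simp_all
    have m2: "u - v \<in> D" "A (u - v) = - (a *\<^sub>C u) - a *\<^sub>C v"
      using mem[of "-1"] by simp_all
    have half: "(1/2) *\<^sub>C (z + z) = z" for z :: 'a
      by (simp add: scaleC_add_right complex_vector.scale_left_distrib[symmetric])
    have u_eq: "(1/2) *\<^sub>C ((u + v) + (u - v)) = u"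
      using half[of u] by simp
    then have "u \<in> D" using L(3)[OF m1(1) m2(1)] L(7) by metis
    have "A u = (1/2) *\<^sub>C (A (u + v) + A (u - v))"
      using u_eq L(3,4)[OF m1(1) m2(1)] L(8) by metis
    also have "A (u + v) + A (u - v) = - (a *\<^sub>C u) + - (a *\<^sub>C u)"
      by (simp add: m1 m2)
    also note half
    finally have "Im (cinner (A u) u) = - k"
      using u(1) by (simp add: cinner_minus_left cinner_scaleC_left cinner_norm a_def)
    then show False using real[OF \<open>u \<in> D\<close>] k by simp
  qed
qed

section \<open>The bounded imaginary part\<close>

text \<open>The form \<open>\<langle>F x|y\<rangle> - \<langle>x|F y\<rangle>\<close> is skew-Hermitian and its diagonal is bounded by the width of the strip, so
polarisation bounds the form.  The sharp constant \<open>2 \<alpha>\<close> matters: the form is \<open>2\<i> \<langle>B x|y\<rangle>\<close> for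
an operator \<open>B\<close>, and \<open>\<parallel>B\<parallel> \<le> \<alpha>\<close> is what keeps the numerical range of a symmetric operator plus \<open>\<i> B\<close> in
the strip.\<close>

lemma imaginary_form_bound:
  fixes D :: "'a::complex_hilbert_space set"
  assumes F: "clinear_on D F"
    and strip: "\<And>x. x \<in> D \<Longrightarrow> \<bar>Im (cinner (F x) x)\<bar> \<le> \<alpha> * (norm x)\<^sup>2"
    and x: "x \<in> D" and y: "y \<in> D"
  shows "cmod (cinner (F x) y - cinner x (F y)) \<le> 2 * \<alpha> * norm x * norm y"
proof (cases "x = 0 \<or> y = 0 \<or> cinner (F x) y - cinner x (F y) = 0")
  case True
  then show ?thesis
  proof (elim disjE)
    assume "cinner (F x) y - cinner x (F y) = 0"
    moreover have "0 \<le> \<alpha> * norm x * norm y"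
    proof (cases "x = 0")
      case False
      have "0 \<le> \<alpha> * (norm x)\<^sup>2" using strip[OF x] by linarith
      then have "0 \<le> \<alpha>" using False by (simp add: zero_le_mult_iff)
      then show ?thesis by simp
    qed simp
    ultimately show ?thesis by simp
  qed (simp_all add: clinear_onD(2)[OF F])
next
  case False
  note L = clinear_onD[OF F]
  define b where "b x y = cinner (F x) y - cinner x (F y)" for x y
  have Im_le: "\<bar>Im (b p q)\<bar> \<le> \<alpha> * ((norm p)\<^sup>2 + (norm q)\<^sup>2)" if p: "p \<in> D" and q: "q \<in> D" for p q
  proof -
    have diag: "\<bar>Im (b z z)\<bar> \<le> 2 * \<alpha> * (norm z)\<^sup>2" if "z \<in> D" for z
      using strip[OF that] cinner_commute[of z "F z"] by (simp add: b_def)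
    have "4 * Im (b p q) = Im (b (p + q) (p + q)) - Im (b (p - q) (p - q))"
      using cinner_commute[of p "F q"] cinner_commute[of q "F p"]
      by (simp add: b_def L p q cinner_algebra)
    moreover have "(norm (p + q))\<^sup>2 + (norm (p - q))\<^sup>2 = 2 * ((norm p)\<^sup>2 + (norm q)\<^sup>2)"
      by (simp add: norm_add_square norm_diff_square)
    then have "\<alpha> * (norm (p + q))\<^sup>2 + \<alpha> * (norm (p - q))\<^sup>2 = 2 * (\<alpha> * ((norm p)\<^sup>2 + (norm q)\<^sup>2))"
      by (metis distrib_left mult.left_commute)
    ultimately show ?thesis
      using diag[OF L(3)[OF p q]] diag[OF L(5)[OF p q]] by (simp add: abs_le_iff)
  qed
  define r where "r = cmod (b x y)"
  have r: "r \<noteq> 0" "norm x \<noteq> 0" "norm y \<noteq> 0" using False by (simp_all add: r_def b_def)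
  have r0: "0 \<le> r" by (simp add: r_def)
  \<comment> \<open>Rescale to unit vectors and rotate the value of the form onto the imaginary axis.\<close>
  define t where "t = \<i> * cnj (b x y) / complex_of_real (r * norm x)"
  define s where "s = complex_of_real (1 / norm y)"
  have "b (t *\<^sub>C x) (s *\<^sub>C y) = t * s * b x y"
    by (simp add: b_def L x y cinner_scaleC_left cinner_scaleC_right s_def algebra_simps)
  also have "\<dots> = \<i> * complex_of_real (r / (norm x * norm y))"
  proof -
    have "b x y * cnj (b x y) = complex_of_real r * complex_of_real r"
      unfolding r_def complex_norm_square[symmetric] by (simp add: power2_eq_square)
    then show ?thesis using r by (simp add: t_def s_def field_simps)
  qed
  finally have "Im (b (t *\<^sub>C x) (s *\<^sub>C y)) = r / (norm x * norm y)" by simp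
  moreover have "norm (t *\<^sub>C x) = 1" "norm (s *\<^sub>C y) = 1"
    using r r0 by (simp_all add: t_def s_def norm_scaleC norm_divide norm_mult r_def[symmetric])
  ultimately have "r / (norm x * norm y) \<le> 2 * \<alpha>"
    using Im_le[OF L(7)[OF x, of t] L(7)[OF y, of s]] r0 by simp
  then show ?thesis
    using r by (simp add: r_def b_def divide_le_eq mult.assoc)
qed

text \<open>The imaginary part of an operator with numerical range in a strip is bounded, so it extends from \<open>D\<close> to
the whole space.  Riesz representation yields \<open>B\<^sub>0\<close> on \<open>D\<close> with \<open>\<langle>B\<^sub>0 x|y\<rangle> = b x y\<close>; representing
\<open>\<langle>B\<^sub>0 \<cdot>|x\<rangle>\<close> for an arbitrary vector \<open>x\<close>, that is, taking the adjoint of \<open>B\<^sub>0\<close>, then gives \<open>B\<close>, which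
agrees with \<open>B\<^sub>0\<close> on \<open>D\<close> because the form is Hermitian.\<close>

lemma bounded_imaginary_part:
  fixes D :: "'a::complex_hilbert_space set"
  assumes F: "clinear_on D F" and dense: "closure D = UNIV" and \<alpha>: "0 \<le> \<alpha>"
    and strip: "\<And>x. x \<in> D \<Longrightarrow> \<bar>Im (cinner (F x) x)\<bar> \<le> \<alpha> * (norm x)\<^sup>2"
  obtains B where "clinear_on UNIV B" "\<And>x. norm (B x) \<le> \<alpha> * norm x"
    "\<And>x y. x \<in> D \<Longrightarrow> y \<in> D \<Longrightarrow> cinner (F x) y - cinner x (F y) = 2 * \<i> * cinner (B x) y"
proof -
  note L = clinear_onD[OF F]
  have D: "complex_vector.subspace D" using F by (simp add: clinear_on_def)
  define b where "b x y = (- \<i> / 2) * (cinner (F x) y - cinner x (F y))" for x y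
  have b_bound: "cmod (b x y) \<le> \<alpha> * norm y * norm x" if "x \<in> D" "y \<in> D" for x y
    using imaginary_form_bound[OF F strip that] by (simp add: b_def norm_mult mult_ac)
  have b_herm: "b y x = cnj (b x y)" for x y
    using cinner_commute[of x "F y"] cinner_commute[of y "F x"]
    by (simp add: b_def complex_eq_iff field_simps)
  have "\<exists>z. norm z \<le> \<alpha> * norm x \<and> (\<forall>y\<in>D. b y x = cinner y z)" if x: "x \<in> D" for x
    using riesz_on_subspace[OF D, of "\<lambda>y. b y x" "\<alpha> * norm x"] \<alpha> b_bound[OF _ x] L(3,4,7,8)
    by (fastforce simp: b_def cinner_algebra algebra_simps)
  then obtain B0 where B0_bound: "\<And>x. x \<in> D \<Longrightarrow> norm (B0 x) \<le> \<alpha> * norm x"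
    and B0: "\<And>x y. x \<in> D \<Longrightarrow> y \<in> D \<Longrightarrow> b y x = cinner y (B0 x)"
    by metis
  have B0': "cinner (B0 x) y = b x y" if "x \<in> D" "y \<in> D" for x y
    using B0[OF that] b_herm[of x y] cinner_commute[of y "B0 x"] by simp
  have B0_add: "B0 (x + y) = B0 x + B0 y" if "x \<in> D" "y \<in> D" for x y
  proof (rule eq_if_cinner_eq_on_dense[OF dense])
    fix z assume "z \<in> D"
    then show "cinner z (B0 (x + y)) = cinner z (B0 x + B0 y)"
      using that L(3,4)[OF that]
      by (simp add: B0[symmetric] cinner_add_right b_def algebra_simps add_divide_distrib diff_divide_distrib)
  qed
  have B0_scale: "B0 (c *\<^sub>C x) = c *\<^sub>C B0 x" if "x \<in> D" for c x
  proof (rule eq_if_cinner_eq_on_dense[OF dense])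
    fix z assume "z \<in> D"
    then show "cinner z (B0 (c *\<^sub>C x)) = cinner z (c *\<^sub>C B0 x)"
      using that L(7,8)[OF that]
      by (simp add: B0[symmetric] cinner_scaleC_right b_def algebra_simps)
  qed
  have "\<exists>z. norm z \<le> \<alpha> * norm x \<and> (\<forall>y\<in>D. cinner (B0 y) x = cinner y z)" for x
  proof -
    have "cmod (cinner (B0 y) x) \<le> \<alpha> * norm x * norm y" if "y \<in> D" for y
    proof -
      have "cmod (cinner (B0 y) x) \<le> norm (B0 y) * norm x" by (rule cauchy_schwarz)
      also have "\<dots> \<le> \<alpha> * norm y * norm x" by (intro mult_right_mono B0_bound that) simp
      finally show ?thesis by (simp add: mult_ac)
    qed
    then show ?thesis
      using riesz_on_subspace[OF D, of "\<lambda>y. cinner (B0 y) x" "\<alpha> * norm x"] \<alpha>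
      by (fastforce simp: B0_add B0_scale cinner_algebra)
  qed
  then obtain B where B_bound: "\<And>x. norm (B x) \<le> \<alpha> * norm x"
    and B: "\<And>x y. y \<in> D \<Longrightarrow> cinner (B0 y) x = cinner y (B x)"
    by metis
  show thesis
  proof (rule that)
    have "B (x + y) = B x + B y" for x y
      by (rule eq_if_cinner_eq_on_dense[OF dense]) (simp add: B[symmetric] cinner_add_right)
    moreover have "B (c *\<^sub>C x) = c *\<^sub>C B x" for c x
      by (rule eq_if_cinner_eq_on_dense[OF dense]) (simp add: B[symmetric] cinner_scaleC_right)
    ultimately show "clinear_on UNIV B" by (simp add: clinear_on_def)
    show "norm (B x) \<le> \<alpha> * norm x" for x by (rule B_bound)
    show "cinner (F x) y - cinner x (F y) = 2 * \<i> * cinner (B x) y" if "x \<in> D" "y \<in> D" for x y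
    proof -
      have "cinner y (B x) = b y x" using B[OF that(2)] B0'[OF that(2,1)] by simp
      then have "cinner (B x) y = b x y"
        by (subst cinner_commute) (simp add: b_herm[of x y])
      then show ?thesis by (simp add: b_def)
    qed
  qed
qed

section \<open>Maximality and surjectivity\<close>

text \<open>Maximality in terms of vectors: if setting \<open>T w = g\<close> keeps the numerical range inside \<open>N\<close>, then \<open>w\<close>
already belongs to the domain, for otherwise this prescription defines a proper extension of \<open>T\<close>
to the span of the domain and \<open>w\<close>.\<close>

lemma maximal_contains:
  fixes T :: "'a::complex_hilbert_space \<rightharpoonup> 'a"
  assumes T: "is_operator T" and max: "nr_maximal N T"
    and N: "\<And>x t. x \<in> dom T \<Longrightarrow> norm (x + t *\<^sub>C w) = 1 \<Longrightarrow>
      cinner (the (T x) + t *\<^sub>C g) (x + t *\<^sub>C w) \<in> N"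
  shows "w \<in> dom T"
proof (rule ccontr)
  assume w: "w \<notin> dom T"
  note L = clinear_onD[OF T[unfolded is_operator_iff]]
  \<comment> \<open>The coefficient of \<open>w\<close> in the direct sum of the domain of \<open>T\<close> and the span of \<open>w\<close>.\<close>
  define c where "c z = (THE t. z - t *\<^sub>C w \<in> dom T)" for z
  define T' where "T' z = (if \<exists>t. z - t *\<^sub>C w \<in> dom T
      then Some (the (T (z - c z *\<^sub>C w)) + c z *\<^sub>C g) else None)" for z
  have c: "c z = t" if "z - t *\<^sub>C w \<in> dom T" for z t
    unfolding c_def
  proof (rule the_equality)
    show "z - t *\<^sub>C w \<in> dom T" by (rule that)
    fix s assume "z - s *\<^sub>C w \<in> dom T"
    then have "(z - s *\<^sub>C w) - (z - t *\<^sub>C w) \<in> dom T" using that by (rule L(5))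
    then have d: "(t - s) *\<^sub>C w \<in> dom T"
      by (simp add: complex_vector.scale_left_diff_distrib)
    show "s = t"
    proof (rule ccontr)
      assume "s \<noteq> t"
      then have "inverse (t - s) *\<^sub>C (t - s) *\<^sub>C w = w" by simp
      then show False using L(7)[OF d, of "inverse (t - s)"] w by simp
    qed
  qed
  have T'_eq: "T' (x + t *\<^sub>C w) = Some (the (T x) + t *\<^sub>C g)" if "x \<in> dom T" for x t
  proof -
    have m: "(x + t *\<^sub>C w) - t *\<^sub>C w \<in> dom T" using that by simp
    then have "\<exists>s. (x + t *\<^sub>C w) - s *\<^sub>C w \<in> dom T" by blast
    then show ?thesis by (simp add: T'_def c[OF m])
  qed
  have domT': "\<exists>x\<in>dom T. \<exists>t. z = x + t *\<^sub>C w" if z: "z \<in> dom T'" for z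
  proof -
    obtain t where "z - t *\<^sub>C w \<in> dom T"
      using z by (auto simp: T'_def dom_def split: if_splits)
    then show ?thesis by (intro bexI[of _ "z - t *\<^sub>C w"]) auto
  qed
  have in_dom: "x + t *\<^sub>C w \<in> dom T'" if "x \<in> dom T" for x t
    using T'_eq[OF that] by blast
  have op: "is_operator T'"
  proof -
    have add: "z + z' \<in> dom T' \<and> the (T' (z + z')) = the (T' z) + the (T' z')"
      if zz: "z \<in> dom T'" "z' \<in> dom T'" for z z'
    proof -
      obtain x t x' t' where x: "x \<in> dom T" "z = x + t *\<^sub>C w" "x' \<in> dom T" "z' = x' + t' *\<^sub>C w"
        using domT' zz by metis
      have "z + z' = (x + x') + (t + t') *\<^sub>C w" by (simp add: x scaleC_add_left)
      then show ?thesis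
        using L(3,4)[OF x(1,3)] T'_eq[OF x(1), of t] T'_eq[OF x(3), of t']
          T'_eq[of "x + x'" "t + t'"] in_dom[of "x + x'" "t + t'"]
        by (simp add: x(2,4) scaleC_add_left ac_simps)
    qed
    have scale: "a *\<^sub>C z \<in> dom T' \<and> the (T' (a *\<^sub>C z)) = a *\<^sub>C the (T' z)" if z: "z \<in> dom T'" for a z
    proof -
      obtain x t where x: "x \<in> dom T" "z = x + t *\<^sub>C w" using domT' z by metis
      have "a *\<^sub>C z = a *\<^sub>C x + (a * t) *\<^sub>C w" by (simp add: x scaleC_add_right scaleC_scaleC)
      then show ?thesis
        using L(7,8)[OF x(1), of a] T'_eq[OF x(1), of t] T'_eq[of "a *\<^sub>C x" "a * t"]
          in_dom[of "a *\<^sub>C x" "a * t"]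
        by (simp add: x(2) scaleC_add_right scaleC_scaleC)
    qed
    have "0 \<in> dom T'" using in_dom[OF L(1), of 0] by simp
    then show ?thesis
      unfolding is_operator_def using add scale
      by (intro conjI complex_vector.subspaceI) simp_all
  qed
  have "T \<subseteq>\<^sub>m T'"
    using T'_eq[of _ 0] by (auto simp: map_le_def)
  moreover have "numerical_range T' \<subseteq> N"
  proof
    fix a assume "a \<in> numerical_range T'"
    then obtain z where z: "z \<in> dom T'" "norm z = 1" "a = cinner (the (T' z)) z"
      by (auto simp: numerical_range_def)
    obtain x t where x: "x \<in> dom T" "z = x + t *\<^sub>C w" using domT' z(1) by metis
    show "a \<in> N" using N[OF x(1), of t] z x T'_eq[OF x(1), of t] by simp
  qed
  ultimately have "T = T'" using max op by (auto simp: nr_maximal_def)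
  then show False using in_dom[OF L(1), of 1] w by simp
qed

text \<open>Subtracting the bounded imaginary part leaves \<open>A = F - \<i> B\<close>, which is symmetric.  It inherits maximality:
a symmetric extension of \<open>A\<close> by \<open>w \<mapsto> g\<close> yields the extension of \<open>F\<close> by \<open>w \<mapsto> g + \<i> B w\<close>, whose imaginary
part is still given by \<open>B\<close>.  So \<open>A - \<i> s\<close> is surjective for some \<open>s\<close> of absolute value
\<open>\<alpha> + 1\<close>, and adding back \<open>\<i> B\<close>, of norm at most \<open>\<alpha>\<close>, preserves surjectivity.\<close>

lemma maximal_strip_surjective:
  fixes D :: "'a::complex_hilbert_space set"
  assumes F: "clinear_on D F" and dense: "closure D = UNIV" and \<alpha>: "0 \<le> \<alpha>"
    and strip: "\<And>x. x \<in> D \<Longrightarrow> \<bar>Im (cinner (F x) x)\<bar> \<le> \<alpha> * (norm x)\<^sup>2"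
    and max: "\<And>w g. (\<And>x t. x \<in> D \<Longrightarrow>
        \<bar>Im (cinner (F x + t *\<^sub>C g) (x + t *\<^sub>C w))\<bar> \<le> \<alpha> * (norm (x + t *\<^sub>C w))\<^sup>2) \<Longrightarrow> w \<in> D"
  shows "\<exists>c. \<alpha> < \<bar>Im c\<bar> \<and> (\<lambda>x. F x - c *\<^sub>C x) ` D = UNIV"
proof -
  obtain B where B: "clinear_on UNIV B" and B_bound: "\<And>x. norm (B x) \<le> \<alpha> * norm x"
    and B_form: "\<And>x y. x \<in> D \<Longrightarrow> y \<in> D \<Longrightarrow> cinner (F x) y - cinner x (F y) = 2 * \<i> * cinner (B x) y"
    using bounded_imaginary_part[OF F dense \<alpha> strip] by blast
  note LB = clinear_onD[OF B]
  define A where "A x = F x - \<i> *\<^sub>C B x" for x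
  have A: "clinear_on D A"
    using clinear_on_add[OF F clinear_on_scaleC[OF B, of "- \<i>"]] by (simp add: A_def[abs_def])
  note L = clinear_onD[OF A]
  have sym: "cinner (A x) y = cinner x (A y)" if "x \<in> D" "y \<in> D" for x y
  proof -
    have "cinner (B y) x = cnj (cinner (B x) y)"
    proof -
      have "2 * \<i> * cinner (B y) x = - cnj (cinner (F x) y - cinner x (F y))"
        using B_form[OF that(2,1)] cinner_commute[of x "F y"] cinner_commute[of y "F x"] by simp
      then show ?thesis unfolding B_form[OF that] by simp
    qed
    then show ?thesis
      using B_form[OF that] cinner_commute[of x "B y"]
      by (simp add: A_def cinner_diff_left cinner_diff_right cinner_scaleC_left cinner_scaleC_right
          algebra_simps)
  qed
  have maxA: "w \<in> D"
    if adj: "\<And>x. x \<in> D \<Longrightarrow> cinner (A x) w = cinner x g" and Im: "Im (cinner g w) = 0" for w g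
  proof (rule max)
    fix x t assume x: "x \<in> D"
    define z where "z = x + t *\<^sub>C w"
    have "Im (cinner (A x) x) = 0"
      using sym[OF x x] cinner_commute[of x "A x"] by (simp add: complex_eq_iff)
    moreover have "cinner g x = cnj (cinner (A x) w)"
      using adj[OF x] cinner_commute[of x g] by simp
    ultimately have "Im (cinner (A x + t *\<^sub>C g) z) = 0"
      using Im by (simp add: z_def cinner_algebra algebra_simps)
    moreover have "F x + t *\<^sub>C (g + \<i> *\<^sub>C B w) = (A x + t *\<^sub>C g) + \<i> *\<^sub>C B z"
      using LB(4,8) by (simp add: A_def z_def scaleC_add_right scaleC_scaleC mult.commute)
    ultimately have "\<bar>Im (cinner (F x + t *\<^sub>C (g + \<i> *\<^sub>C B w)) z)\<bar> = \<bar>Re (cinner (B z) z)\<bar>"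
      by (simp add: cinner_add_left cinner_scaleC_left)
    also have "\<dots> \<le> norm (B z) * norm z"
      using abs_Re_le_cmod cauchy_schwarz order_trans by blast
    also have "\<dots> \<le> \<alpha> * norm z * norm z"
      by (intro mult_right_mono B_bound) simp
    finally show "\<bar>Im (cinner (F x + t *\<^sub>C (g + \<i> *\<^sub>C B w)) (x + t *\<^sub>C w))\<bar> \<le> \<alpha> * (norm (x + t *\<^sub>C w))\<^sup>2"
      by (simp add: z_def power2_eq_square mult.assoc)
  qed
  have k: "0 < \<alpha> + 1" using \<alpha> by simp
  obtain s where s: "s \<in> {\<alpha> + 1, - (\<alpha> + 1)}"
    and surj: "(\<lambda>x. A x - (\<i> * complex_of_real s) *\<^sub>C x) ` D = UNIV"
    by (rule bexE[OF maximal_symmetric_surjective[OF A dense sym maxA k]])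
  have "(\<lambda>x. (A x - (\<i> * complex_of_real s) *\<^sub>C x) + \<i> *\<^sub>C B x) ` D = UNIV"
  proof (rule surj_perturb[OF clinear_on_shift[OF A] surj _ clinear_on_scaleC[OF B]])
    show "norm (\<i> *\<^sub>C B x) \<le> \<alpha> * norm x" for x
      using B_bound by (simp add: norm_scaleC)
    show "(\<alpha> + 1) * norm x \<le> norm (A x - (\<i> * complex_of_real s) *\<^sub>C x)" if x: "x \<in> D" for x
    proof -
      have "Im (cinner (A x) x) = 0"
        using sym[OF x x] cinner_commute[of x "A x"] by (simp add: complex_eq_iff)
      then show ?thesis using symmetric_lower_bound[of "A x" x s] s \<alpha> by (auto simp: add.commute)
    qed
  qed (use \<alpha> in auto)
  moreover have "\<alpha> < \<bar>Im (\<i> * complex_of_real s)\<bar>" using s \<alpha> by auto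
  ultimately show ?thesis
    by (intro exI[of _ "\<i> * complex_of_real s"]) (simp add: A_def)
qed

section \<open>Closed strips\<close>

lemma closed_strip_halfplanes:
  assumes "closed_strip S"
  obtains a b \<alpha> where "a \<noteq> 0" "0 \<le> \<alpha>" "S = {z. \<bar>Im ((z - b) / a)\<bar> \<le> \<alpha>}"
proof -
  obtain a :: complex and b \<alpha> :: real where a: "a \<noteq> 0" and \<alpha>: "0 \<le> \<alpha>"
    and S: "S = (\<lambda>z. a * z + complex_of_real b) ` {z. \<bar>Im z\<bar> \<le> \<alpha>}"
    using assms by (auto simp: closed_strip_def)
  have "S = {z. \<bar>Im ((z - complex_of_real b) / a)\<bar> \<le> \<alpha>}"
  proof (intro set_eqI iffI)
    fix z assume "z \<in> {z. \<bar>Im ((z - complex_of_real b) / a)\<bar> \<le> \<alpha>}"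
    then show "z \<in> S"
      unfolding S using a by (intro image_eqI[of _ _ "(z - complex_of_real b) / a"]) auto
  qed (use a in \<open>auto simp: S\<close>)
  then show thesis using that a \<alpha> by blast
qed

lemma closed_strip_closed_nonempty:
  assumes "closed_strip S"
  shows "closed S" "S \<noteq> {}"
proof -
  obtain a b \<alpha> where a: "a \<noteq> 0" "0 \<le> \<alpha>" and S: "S = {z. \<bar>Im ((z - b) / a)\<bar> \<le> \<alpha>}"
    using closed_strip_halfplanes[OF assms] .
  show "closed S" unfolding S using a by (intro closed_Collect_le continuous_intros) auto
  have "b \<in> S" using a by (simp add: S)
  then show "S \<noteq> {}" by blast
qed

text \<open>The affine map that straightens \<open>S\<close> to the strip \<open>\<bar>Im z\<bar> \<le> \<alpha>\<close>, applied to \<open>T\<close>, reduces the claim to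
the horizontal strip.\<close>

lemma surjective_shift_if_maximal:
  assumes S: "closed_strip S" and T: "is_operator T"
    and max: "nr_maximal S T" and dense: "densely_defined T"
  shows "\<exists>c\<in>- S. ran (op_shift T c) = UNIV"
proof -
  have nr: "numerical_range T \<subseteq> S" using max by (simp add: nr_maximal_def)
  obtain a b \<alpha> where a: "a \<noteq> 0" and \<alpha>: "0 \<le> \<alpha>" and S_eq: "S = {z. \<bar>Im ((z - b) / a)\<bar> \<le> \<alpha>}"
    using closed_strip_halfplanes[OF S] .
  define F where "F x = inverse a *\<^sub>C (the (T x) - b *\<^sub>C x)" for x
  have aF: "a *\<^sub>C F x = the (T x) - b *\<^sub>C x" for x
    using a by (simp add: F_def)
  have F: "clinear_on (dom T) F"
    unfolding F_def[abs_def]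
    using T unfolding is_operator_iff by (intro clinear_on_scaleC clinear_on_shift)
  have strip: "\<bar>Im (cinner (F x) x)\<bar> \<le> \<alpha> * (norm x)\<^sup>2" if x: "x \<in> dom T" for x
  proof (cases "x = 0")
    case False
    define n where "n = complex_of_real ((norm x)\<^sup>2)"
    define q where "q = cinner (the (T x)) x / n"
    have n: "n \<noteq> 0" using False by (simp add: n_def)
    have q: "\<bar>Im ((q - b) / a)\<bar> \<le> \<alpha>"
      using rayleigh_quotient_in_numerical_range[OF T x False] nr
      by (auto simp: S_eq q_def n_def)
    have F_eq: "cinner (F x) x = (q - b) / a * n"
      using n by (simp add: F_def cinner_scaleC_left cinner_diff_left cinner_norm q_def
          n_def[symmetric] divide_simps left_diff_distrib del: of_real_power)
    have "Im (cinner (F x) x) = Im ((q - b) / a) * (norm x)\<^sup>2"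
      unfolding F_eq
      by (simp only: n_def times_complex.sel Re_complex_of_real Im_complex_of_real)
    then have "\<bar>Im (cinner (F x) x)\<bar> = \<bar>Im ((q - b) / a)\<bar> * (norm x)\<^sup>2"
      by (simp only: abs_mult abs_power2)
    with q show ?thesis by (simp add: mult_right_mono)
  qed simp
  have contains: "w \<in> dom T"
    if wg: "\<And>x t. x \<in> dom T \<Longrightarrow>
        \<bar>Im (cinner (F x + t *\<^sub>C g) (x + t *\<^sub>C w))\<bar> \<le> \<alpha> * (norm (x + t *\<^sub>C w))\<^sup>2" for w g
    \<comment> \<open>Undoing the affine map: extending \<open>F\<close> by \<open>w \<mapsto> g\<close> means extending \<open>T\<close> by \<open>w \<mapsto> a g + b w\<close>.\<close>
  proof (rule maximal_contains[OF T max])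
    fix x t assume x: "x \<in> dom T" and unit: "norm (x + t *\<^sub>C w) = 1"
    define z where "z = x + t *\<^sub>C w"
    have "the (T x) + t *\<^sub>C (a *\<^sub>C g + b *\<^sub>C w) = a *\<^sub>C (F x + t *\<^sub>C g) + b *\<^sub>C z"
      by (simp add: scaleC_add_right aF z_def scaleC_scaleC mult.commute)
    then have "(cinner (the (T x) + t *\<^sub>C (a *\<^sub>C g + b *\<^sub>C w)) z - b) / a = cinner (F x + t *\<^sub>C g) z"
      using unit a by (simp add: z_def[symmetric] cinner_add_left cinner_scaleC_left cinner_norm)
    then show "cinner (the (T x) + t *\<^sub>C (a *\<^sub>C g + b *\<^sub>C w)) (x + t *\<^sub>C w) \<in> S"
      using wg[OF x, of t] unit by (simp add: S_eq z_def)
  qed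
  have "\<exists>c. \<alpha> < \<bar>Im c\<bar> \<and> (\<lambda>x. F x - c *\<^sub>C x) ` dom T = UNIV"
  proof (rule maximal_strip_surjective[OF F _ \<alpha>])
    show "closure (dom T) = UNIV" using dense by (simp add: densely_defined_def)
    show "\<bar>Im (cinner (F x) x)\<bar> \<le> \<alpha> * (norm x)\<^sup>2" if "x \<in> dom T" for x
      using that by (rule strip)
    show "w \<in> dom T"
      if "\<And>x t. x \<in> dom T \<Longrightarrow>
        \<bar>Im (cinner (F x + t *\<^sub>C g) (x + t *\<^sub>C w))\<bar> \<le> \<alpha> * (norm (x + t *\<^sub>C w))\<^sup>2" for w g
      using that by (rule contains)
  qed
  then obtain c where c: "\<alpha> < \<bar>Im c\<bar>" and surj: "(\<lambda>x. F x - c *\<^sub>C x) ` dom T = UNIV"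
    by blast
  have "y \<in> ran (op_shift T (a * c + b))" for y
  proof -
    obtain x where x: "x \<in> dom T" "inverse a *\<^sub>C y = F x - c *\<^sub>C x"
      using surj by (metis (no_types, lifting) UNIV_I imageE)
    have "y = a *\<^sub>C inverse a *\<^sub>C y" using a by simp
    also have "\<dots> = the (T x) - (a * c + b) *\<^sub>C x"
      by (simp add: x(2) complex_vector.scale_right_diff_distrib aF scaleC_add_left)
    finally show ?thesis using x(1) by (auto simp: ran_op_shift)
  qed
  then have "ran (op_shift T (a * c + b)) = UNIV" by blast
  moreover have "a * c + b \<notin> S" using a c by (simp add: S_eq)
  ultimately show ?thesis by blast
qed

theorem theorem5p5:
  fixes T :: "'a::complex_hilbert_space \<rightharpoonup> 'a"
    and S :: "complex set"
  assumes "closed_strip S"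
    and "is_operator T"
    and "numerical_range T \<subseteq> S"
  shows "((\<exists>c\<in>- S. ran (op_shift T c) = UNIV) \<longleftrightarrow>
            (\<exists>C\<in>components (- S). C \<subseteq> resolvent_set T)) \<and>
         ((\<exists>C\<in>components (- S). C \<subseteq> resolvent_set T) \<longleftrightarrow>
            nr_maximal S T \<and> densely_defined T) \<and>
         (closed_operator T \<longrightarrow>
            ((\<exists>C\<in>components (- S). C \<subseteq> resolvent_set T) \<longleftrightarrow> is_defect_index S T 0)) \<and>
         ((\<exists>c\<in>- S. ran (op_shift T c) = UNIV) \<longrightarrow> closed_operator T)"
    (is "(?surj \<longleftrightarrow> ?res) \<and> (_ \<longleftrightarrow> ?max) \<and> (_ \<longrightarrow> (_ \<longleftrightarrow> ?defect)) \<and> _")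
proof -
  note S = closed_strip_closed_nonempty[OF assms(1)]
  note T = assms(2,3)
  note res_iff = resolvent_set_iff_surjective[OF T S]
  have surj_res: ?res if surj: ?surj
  proof -
    obtain c where c: "c \<in> - S" "ran (op_shift T c) = UNIV" using surj by blast
    define C where "C = connected_component_set (- S) c"
    have C: "C \<in> components (- S)" using c(1) by (auto simp: C_def components_def)
    have sub: "C \<subseteq> - S" using C by (rule in_components_subset)
    have "c' \<in> resolvent_set T" if "c' \<in> C" for c'
    proof -
      have "c \<in> C" using c(1) by (simp add: C_def)
      then have "ran (op_shift T c') = UNIV"
        using surjective_shift_on_connected[OF T S in_components_connected[OF C] sub _ c(2) that]
        by blast
      then show ?thesis using res_iff[of c'] sub that by blast
    qed
    then show ?res using C by blast
  qed
  have res_surj: ?surj if res: ?res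
  proof -
    obtain C where C: "C \<in> components (- S)" "C \<subseteq> resolvent_set T" using res by blast
    obtain c where "c \<in> C" using in_components_nonempty[OF C(1)] by blast
    moreover from this have "c \<in> - S" using in_components_subset[OF C(1)] by blast
    ultimately show ?surj using res_iff[of c] C(2) by blast
  qed
  have surj_max: ?max if ?surj
    using that maximal_if_surjective_shift[OF T S] densely_defined_if_surjective_shift[OF T S]
    by blast
  have max_surj: ?surj if ?max
    using that surjective_shift_if_maximal[OF assms(1,2)] by blast
  have closed: "closed_operator T" if ?surj
    using that closed_if_surjective_shift[OF T S] by blast
  have defect: "?res \<longleftrightarrow> ?defect" if "closed_operator T"
  proof -
    have "c \<in> resolvent_set T \<longleftrightarrow> cdim (orth_compl (ran (op_shift T c))) = 0"
      if "C \<in> components (- S)" "c \<in> C" for C c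
    proof -
      have c: "c \<notin> S" using that in_components_subset by blast
      show ?thesis
        using res_iff[OF c] closed_surjective_shift_iff_cdim[OF T S c \<open>closed_operator T\<close>] by simp
    qed
    then show ?thesis unfolding is_defect_index_def by (meson subset_iff)
  qed
  show ?thesis using surj_res res_surj surj_max max_surj closed defect by blast
qed

end
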